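(* Let $\mathcal T$ be a field theory, given by a set $\mathcal E(\mathcal T)$ of half-edge types and a set $\mathcal V(\mathcal T)$ of vertex types. Let $\widetilde{\mathcal H}_{\mathcal T}=S(\widetilde V_{\mathcal T})$ be the vector space generated by the superficially divergent, locally 1PI, not necessarily connected graphs of $\mathcal T$, with product given by concatenation (disjoint union), unit $\mathbf 1$ the empty graph, and with coproduct $$\Delta(\Gamma)=\sum_{\gamma\subseteq\Gamma,\ \Gamma/\gamma\in\mathcal T}\gamma\otimes\Gamma/\gamma ,$$ where $\gamma$ runs over all locally 1PI covering subgraphs of $\Gamma$ such that the contracted graph $\Gamma/\gamma$ is in the theory $\mathcal T$. Then $\widetilde{\mathcal H}_{\mathcal T}$, equipped with this coproduct, is a bialgebra.
   Context: Graphs. A (Feynman) graph $\Gamma$ consists of a finite set $\mathcal V(\Gamma)$ of vertices, a finite set $\mathcal E(\Gamma)$ of half-edges, an involution $\sigma_\Gamma:\mathcal E(\Gamma)\to\mathcal E(\Gamma)$ and a map $\partial:\mathcal E(\Gamma)\to\mathcal V(\Gamma)$. For a vertex $v$, $st(v)=\{e:\partial(e)=v\}$. Fixed points of $\sigma_\Gamma$ are the external edges; pairs $\{e,\sigma_\Gamma(e)\}$ with $e\ne\sigma_\Gamma(e)$ are the internal edges. Cutting an internal edge $\{e,\sigma_\Gamma(e)\}$ means modifying $\sigma_\Gamma$ so that $e$ and $\sigma_\Gamma(e)$ become fixed points. $\pi_0(\Gamma)$ is the set of connected components. A graph is 1PI (one-particle irreducible) if it is connected and remains connected when any one internal edge is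 cut; it is locally 1PI if each connected component is 1PI (the empty graph is locally 1PI). A covering subgraph $\gamma$ of $\Gamma$ is a graph obtained from $\Gamma$ by cutting some (possibly no, possibly all) internal edges: same vertices, same half-edges, same $\partial$, and $\sigma_\gamma(e)\in\{e,\sigma_\Gamma(e)\}$ with $\sigma_\gamma(e)=e$ implying $\sigma_\gamma(\sigma_\Gamma(e))=\sigma_\Gamma(e)$. The contracted graph $\Gamma/\gamma$ is obtained by shrinking each connected component of $\gamma$ to a point: its vertices are the connected components of $\gamma$, its half-edges are the fixed points of $\sigma_\gamma$, its involution is the restriction of $\sigma_\Gamma$, and a half-edge $e$ is attached to the component of $\gamma$ containing $\partial(e)$. The residue is $\mathrm{res}\,\Gamma=\Gamma/\Gamma$. Theory. Every half-edge carries a type in $\mathcal E(\mathcal T)$ and $\sigma_\Gamma$ preserves types. The type of a vertex $v$ is the function $\mathcal E(\mathcal T)\to\mathbb N$ sending each half-edge type to the number of half-edges of that type in $st(v)$; $\mathcal V(\mathcal T)$ is a prescribed set of such functions. A graph is in the theory $\mathcal T$ if all its vertices have type in $\mathcal V(\mathcal T)$. $\widetilde V_{\mathcal T}$ is the set of 1PI connected graphs in $\mathcal T$ whose residue is a vertex with type in $\mathcal V(\mathcal T)$ (superficial divergence); a non-connected graph is superficially divergent if each of its components is. 1PI graphs without internal edges (single vertices) are included in $\widetilde V_{\mathcal T}$. Graphs are taken up to isomorphism (preserving half-edge types). $S(\cdot)$ denotes the free commutative algebra over the base field $\mathbb C$, with basis the (isomorphism classes of) finite disjoint unions of elements of $\widetilde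 V_{\mathcal T}$. *)

theory Defs
  imports Complex_Main "HOL-Library.Poly_Mapping" "HOL-Library.Product_Plus"
begin

section \<open>Graphs\<close>

text \<open>
  The fields are total functions; only their values on the half-edges belong to the graph.
\<close>

record ('v, 'h, 't) fgraph =
  verts :: "'v set"
  hedges :: "'h set"
  invol :: "'h \<Rightarrow> 'h"
  att :: "'h \<Rightarrow> 'v"
  htype :: "'h \<Rightarrow> 't"

definition feynman_graph :: "('v, 'h, 't) fgraph \<Rightarrow> bool" where
  "feynman_graph G \<longleftrightarrow> finite (verts G) \<and> finite (hedges G) \<and>
     (\<forall>e\<in>hedges G. invol G e \<in> hedges G \<and> invol G (invol G e) = e \<and>
        att G e \<in> verts G \<and> htype G (invol G e) = htype G e)"

definition cut :: "'h \<Rightarrow> ('v, 'h, 't) fgraph \<Rightarrow> ('v, 'h, 't) fgraph" where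
  "cut e G = G\<lparr>invol := (invol G)(e := e, invol G e := invol G e)\<rparr>"

definition adjacent :: "('v, 'h, 't) fgraph \<Rightarrow> 'v rel" where
  "adjacent G = {(att G e, att G (invol G e)) | e. e \<in> hedges G \<and> invol G e \<noteq> e}"

definition conn_rel :: "('v, 'h, 't) fgraph \<Rightarrow> 'v rel" where
  "conn_rel G = {(v, w) \<in> verts G \<times> verts G. (v, w) \<in> (adjacent G)\<^sup>*}"

definition components :: "('v, 'h, 't) fgraph \<Rightarrow> 'v set set" where
  "components G = verts G // conn_rel G"

text \<open>The empty graph has no component, so it is not connected (but it is locally 1PI).\<close>

definition connected_graph :: "('v, 'h, 't) fgraph \<Rightarrow> bool" where
  "connected_graph G \<longleftrightarrow> card (components G) = 1"

definition one_PI :: "('v, 'h, 't) fgraph \<Rightarrow> bool" where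
  "one_PI G \<longleftrightarrow> connected_graph G \<and>
     (\<forall>e\<in>hedges G. invol G e \<noteq> e \<longrightarrow> connected_graph (cut e G))"

definition restrict_verts :: "('v, 'h, 't) fgraph \<Rightarrow> 'v set \<Rightarrow> ('v, 'h, 't) fgraph" where
  "restrict_verts G C = G\<lparr>verts := C, hedges := {e \<in> hedges G. att G e \<in> C}\<rparr>"

definition locally_1PI :: "('v, 'h, 't) fgraph \<Rightarrow> bool" where
  "locally_1PI G \<longleftrightarrow> (\<forall>C\<in>components G. one_PI (restrict_verts G C))"

text \<open>
  The first condition on \<open>s\<close> concerns only values outside the graph; it makes every
  covering subgraph appear exactly once in this set.
\<close>

definition covering_subgraphs :: "('v, 'h, 't) fgraph \<Rightarrow> ('v, 'h, 't) fgraph set" where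
  "covering_subgraphs G = {G\<lparr>invol := s\<rparr> | s.
     (\<forall>e. e \<notin> hedges G \<longrightarrow> s e = invol G e) \<and>
     (\<forall>e\<in>hedges G. s e \<in> {e, invol G e} \<and> (s e = e \<longrightarrow> s (invol G e) = invol G e))}"

definition contract :: "('v, 'h, 't) fgraph \<Rightarrow> ('v, 'h, 't) fgraph \<Rightarrow> ('v set, 'h, 't) fgraph" where
  "contract G g = \<lparr>verts = components g, hedges = {e \<in> hedges G. invol g e = e},
     invol = invol G, att = (\<lambda>e. conn_rel g `` {att G e}), htype = htype G\<rparr>"

definition residue :: "('v, 'h, 't) fgraph \<Rightarrow> ('v set, 'h, 't) fgraph" where
  "residue G = contract G G"

definition disjoint_union ::
  "('v, 'h, 't) fgraph \<Rightarrow> ('w, 'k, 't) fgraph \<Rightarrow> ('v + 'w, 'h + 'k, 't) fgraph" where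
  "disjoint_union G H = \<lparr>verts = verts G <+> verts H, hedges = hedges G <+> hedges H,
     invol = map_sum (invol G) (invol H), att = map_sum (att G) (att H),
     htype = case_sum (htype G) (htype H)\<rparr>"

definition empty_graph :: "('v, 'h, 't) fgraph" where
  "empty_graph = \<lparr>verts = {}, hedges = {}, invol = (\<lambda>e. e), att = (\<lambda>_. undefined),
     htype = (\<lambda>_. undefined)\<rparr>"

subsection \<open>Isomorphisms\<close>

definition is_iso ::
  "('v \<Rightarrow> 'w) \<Rightarrow> ('h \<Rightarrow> 'k) \<Rightarrow> ('v, 'h, 't) fgraph \<Rightarrow> ('w, 'k, 't) fgraph \<Rightarrow> bool" where
  "is_iso f g G H \<longleftrightarrow> bij_betw f (verts G) (verts H) \<and> bij_betw g (hedges G) (hedges H) \<and>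
     (\<forall>e\<in>hedges G. invol H (g e) = g (invol G e) \<and> att H (g e) = f (att G e) \<and>
        htype H (g e) = htype G e)"

definition isomorphic :: "('v, 'h, 't) fgraph \<Rightarrow> ('w, 'k, 't) fgraph \<Rightarrow> bool" (infix "\<simeq>" 50) where
  "G \<simeq> H \<longleftrightarrow> (\<exists>f g. is_iso f g G H)"

lemma feynman_graphD:
  assumes "feynman_graph G"
  shows "finite (verts G)" "finite (hedges G)"
    "e \<in> hedges G \<Longrightarrow> invol G e \<in> hedges G"
    "e \<in> hedges G \<Longrightarrow> invol G (invol G e) = e"
    "e \<in> hedges G \<Longrightarrow> att G e \<in> verts G"
    "e \<in> hedges G \<Longrightarrow> htype G (invol G e) = htype G e"
  using assms by (auto simp: feynman_graph_def)

lemma is_isoD: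
  assumes "is_iso f g G H"
  shows "bij_betw f (verts G) (verts H)" "bij_betw g (hedges G) (hedges H)"
    "e \<in> hedges G \<Longrightarrow> invol H (g e) = g (invol G e)"
    "e \<in> hedges G \<Longrightarrow> att H (g e) = f (att G e)"
    "e \<in> hedges G \<Longrightarrow> htype H (g e) = htype G e"
    "v \<in> verts G \<Longrightarrow> f v \<in> verts H"
    "e \<in> hedges G \<Longrightarrow> g e \<in> hedges H"
  using assms by (auto simp: is_iso_def bij_betw_def)

lemma iso_refl: "is_iso id id G G"
  by (simp add: is_iso_def)

lemma isomorphic_refl [simp]: "G \<simeq> G"
  using iso_refl unfolding isomorphic_def by blast

lemma iso_sym:
  assumes "feynman_graph G" "is_iso f g G H"
  shows "is_iso (inv_into (verts G) f) (inv_into (hedges G) g) H G"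
proof -
  note I = is_isoD[OF assms(2)] and F = feynman_graphD[OF assms(1)]
  have "invol G (inv_into (hedges G) g e) = inv_into (hedges G) g (invol H e) \<and>
     att G (inv_into (hedges G) g e) = inv_into (verts G) f (att H e) \<and>
     htype G (inv_into (hedges G) g e) = htype H e" if e: "e \<in> hedges H" for e
  proof -
    obtain d where d: "d \<in> hedges G" "e = g d"
      using I(2) e by (auto simp: bij_betw_def)
    show ?thesis using d I F
      by (simp add: bij_betw_inv_into_left)
  qed
  then show ?thesis unfolding is_iso_def using I(1,2) by (auto intro: bij_betw_inv_into)
qed

lemma isomorphic_sym: "feynman_graph G \<Longrightarrow> G \<simeq> H \<Longrightarrow> H \<simeq> G"
  unfolding isomorphic_def using iso_sym by metis

lemma iso_trans:
  assumes "feynman_graph G" "is_iso f g G H" "is_iso f' g' H K"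
  shows "is_iso (f' \<circ> f) (g' \<circ> g) G K"
  using is_isoD[OF assms(2)] is_isoD[OF assms(3)] feynman_graphD[OF assms(1)]
  by (auto simp: is_iso_def intro: bij_betw_trans)

lemma isomorphic_trans: "feynman_graph G \<Longrightarrow> G \<simeq> H \<Longrightarrow> H \<simeq> K \<Longrightarrow> G \<simeq> K"
  unfolding isomorphic_def using iso_trans by metis

lemma iso_feynman_graph:
  assumes "feynman_graph G" "is_iso f g G H"
  shows "feynman_graph H"
proof -
  note I = is_isoD[OF assms(2)] and F = feynman_graphD[OF assms(1)]
  have "invol H e \<in> hedges H \<and> invol H (invol H e) = e \<and>
        att H e \<in> verts H \<and> htype H (invol H e) = htype H e" if e: "e \<in> hedges H" for e
  proof -
    obtain d where d: "d \<in> hedges G" "e = g d"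
      using I(2) e by (auto simp: bij_betw_def)
    show ?thesis using d I F by simp
  qed
  moreover have "finite (verts H)" "finite (hedges H)"
    using I(1,2) F(1,2) bij_betw_finite by blast+
  ultimately show ?thesis unfolding feynman_graph_def by blast
qed

lemma isomorphic_feynman_graph: "feynman_graph G \<Longrightarrow> G \<simeq> H \<Longrightarrow> feynman_graph H"
  unfolding isomorphic_def using iso_feynman_graph by metis

lemma ex_nat_copy:
  fixes G :: "('v, 'h, 't) fgraph"
  assumes "feynman_graph G"
  shows "\<exists>H :: (nat, nat, 't) fgraph. feynman_graph H \<and> G \<simeq> H"
proof -
  note F = feynman_graphD[OF assms]
  obtain f :: "'v \<Rightarrow> nat" where f: "inj_on f (verts G)"
    using finite_imp_inj_to_nat_seg[OF F(1)] by blast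
  obtain g :: "'h \<Rightarrow> nat" where g: "inj_on g (hedges G)"
    using finite_imp_inj_to_nat_seg[OF F(2)] by blast
  let ?i = "inv_into (hedges G) g"
  let ?H = "\<lparr>verts = f ` verts G, hedges = g ` hedges G, invol = (\<lambda>e. g (invol G (?i e))),
    att = (\<lambda>e. f (att G (?i e))), htype = (\<lambda>e. htype G (?i e))\<rparr>"
  have "is_iso f g G ?H"
    using f g by (simp add: is_iso_def inj_on_imp_bij_betw)
  then show ?thesis using iso_feynman_graph[OF assms] unfolding isomorphic_def by blast
qed

lemma feynman_graph_disjoint_union:
  "feynman_graph G \<Longrightarrow> feynman_graph H \<Longrightarrow> feynman_graph (disjoint_union G H)"
  by (auto simp: feynman_graph_def disjoint_union_def)

lemma feynman_graph_empty: "feynman_graph empty_graph"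
  by (simp add: feynman_graph_def empty_graph_def)

lemma bij_betw_map_sum:
  assumes "bij_betw a A C" "bij_betw b B D"
  shows "bij_betw (map_sum a b) (A <+> B) (C <+> D)"
proof (rule bij_betw_imageI)
  show "inj_on (map_sum a b) (A <+> B)"
    using assms[THEN bij_betw_imp_inj_on] by (auto intro!: inj_onI dest: inj_onD)
  have "map_sum a b ` (A <+> B) = a ` A <+> b ` B"
    unfolding Plus_def image_Un image_image by simp
  then show "map_sum a b ` (A <+> B) = C <+> D"
    using assms by (simp add: bij_betw_def)
qed

lemma disjoint_union_cong:
  assumes "G \<simeq> G'" "H \<simeq> H'"
  shows "disjoint_union G H \<simeq> disjoint_union G' H'"
proof -
  obtain f g f' g' where "is_iso f g G G'" "is_iso f' g' H H'"
    using assms unfolding isomorphic_def by blast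
  note I = is_isoD[OF this(1)] is_isoD[OF this(2)]
  have "is_iso (map_sum f f') (map_sum g g') (disjoint_union G H) (disjoint_union G' H')"
    using I by (auto simp: is_iso_def disjoint_union_def intro!: bij_betw_map_sum)
  then show ?thesis unfolding isomorphic_def by blast
qed

lemma disjoint_union_commute: "disjoint_union G H \<simeq> disjoint_union H G"
proof -
  have *: "bij_betw (case_sum Inr Inl) (A <+> B) (B <+> A)" for A :: "'x set" and B :: "'y set"
    by (rule bij_betw_byWitness[where f' = "case_sum Inr Inl"]) auto
  have "is_iso (case_sum Inr Inl) (case_sum Inr Inl) (disjoint_union G H) (disjoint_union H G)"
    by (auto simp: is_iso_def disjoint_union_def *)
  then show ?thesis unfolding isomorphic_def by blast
qed

lemma disjoint_union_assoc:
  "disjoint_union (disjoint_union G H) K \<simeq> disjoint_union G (disjoint_union H K)"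
proof -
  let ?a = "\<lambda>x. case x of Inl (Inl a) \<Rightarrow> Inl a | Inl (Inr b) \<Rightarrow> Inr (Inl b) | Inr c \<Rightarrow> Inr (Inr c)"
  let ?b = "\<lambda>x. case x of Inl a \<Rightarrow> Inl (Inl a) | Inr (Inl b) \<Rightarrow> Inl (Inr b) | Inr (Inr c) \<Rightarrow> Inr c"
  have *: "bij_betw ?a ((A <+> B) <+> C) (A <+> (B <+> C))"
    for A :: "'x set" and B :: "'y set" and C :: "'z set"
    by (rule bij_betw_byWitness[where f' = ?b]) auto
  have "is_iso ?a ?a (disjoint_union (disjoint_union G H) K) (disjoint_union G (disjoint_union H K))"
    by (auto simp: is_iso_def disjoint_union_def *)
  then show ?thesis unfolding isomorphic_def by blast
qed

lemma disjoint_union_empty: "G \<simeq> disjoint_union empty_graph G"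
proof -
  have "is_iso Inr Inr G (disjoint_union empty_graph G)"
    by (auto simp: is_iso_def disjoint_union_def empty_graph_def bij_betw_def)
  then show ?thesis unfolding isomorphic_def by blast
qed

section \<open>Isomorphism classes of graphs\<close>

text \<open>
  Every finite graph is isomorphic to one whose vertices and half-edges are natural numbers,
  so these suffice as representatives of the isomorphism classes.
\<close>

quotient_type 't igraph = "(nat, nat, 't) fgraph" /
  partial: "\<lambda>G H. feynman_graph G \<and> feynman_graph H \<and> G \<simeq> H"
proof (rule part_equivpI)
  show "\<exists>G :: (nat, nat, 't) fgraph. feynman_graph G \<and> feynman_graph G \<and> G \<simeq> G"
    using feynman_graph_empty isomorphic_refl by blast
  show "symp (\<lambda>G H :: (nat, nat, 't) fgraph. feynman_graph G \<and> feynman_graph H \<and> G \<simeq> H)"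
    by (rule sympI) (blast intro: isomorphic_sym)
  show "transp (\<lambda>G H :: (nat, nat, 't) fgraph. feynman_graph G \<and> feynman_graph H \<and> G \<simeq> H)"
    by (rule transpI) (blast intro: isomorphic_trans)
qed

definition nat_copy :: "('v, 'h, 't) fgraph \<Rightarrow> (nat, nat, 't) fgraph" where
  "nat_copy G = (SOME H. feynman_graph H \<and> G \<simeq> H)"

definition iso_class :: "('v, 'h, 't) fgraph \<Rightarrow> 't igraph" where
  "iso_class G = abs_igraph (nat_copy G)"

lemma nat_copy:
  assumes "feynman_graph G"
  shows "feynman_graph (nat_copy G)" "G \<simeq> nat_copy G"
  using someI_ex[OF ex_nat_copy[OF assms]] by (auto simp: nat_copy_def)

lemma nat_copy_cong:
  assumes "feynman_graph G" "feynman_graph H" "G \<simeq> H"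
  shows "feynman_graph (nat_copy G) \<and> feynman_graph (nat_copy H) \<and> nat_copy G \<simeq> nat_copy H"
proof -
  note n = nat_copy[OF assms(1)] nat_copy[OF assms(2)]
  have "nat_copy G \<simeq> H"
    by (rule isomorphic_trans[OF n(1) isomorphic_sym[OF assms(1) n(2)] assms(3)])
  then show ?thesis using isomorphic_trans[OF n(1) _ n(4)] n by blast
qed

lemma abs_igraph_eq_iff:
  assumes "feynman_graph G" "feynman_graph H"
  shows "abs_igraph G = abs_igraph H \<longleftrightarrow> G \<simeq> H"
  using Quotient3_rel[OF Quotient3_igraph, of G H] assms by simp

lemma iso_class_nat:
  assumes "feynman_graph G"
  shows "iso_class G = abs_igraph G"
  unfolding iso_class_def
  using abs_igraph_eq_iff nat_copy[OF assms] assms isomorphic_sym by blast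

lemma iso_class_eq_iff:
  assumes "feynman_graph G" "feynman_graph H"
  shows "iso_class G = iso_class H \<longleftrightarrow> G \<simeq> H"
proof -
  note n = nat_copy[OF assms(1)] nat_copy[OF assms(2)]
  have "iso_class G = iso_class H \<longleftrightarrow> nat_copy G \<simeq> nat_copy H"
    unfolding iso_class_def using abs_igraph_eq_iff n by blast
  also have "\<dots> \<longleftrightarrow> G \<simeq> H"
  proof
    assume "nat_copy G \<simeq> nat_copy H"
    then have "G \<simeq> nat_copy H" by (rule isomorphic_trans[OF assms(1) n(2)])
    then show "G \<simeq> H" by (rule isomorphic_trans[OF assms(1) _ isomorphic_sym[OF assms(2) n(4)]])
  qed (use nat_copy_cong[OF assms] in blast)
  finally show ?thesis .
qed

instantiation igraph :: (type) comm_monoid_add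
begin

lift_definition zero_igraph :: "'t igraph" is empty_graph
  by (simp add: feynman_graph_empty)

lift_definition plus_igraph :: "'t igraph \<Rightarrow> 't igraph \<Rightarrow> 't igraph"
  is "\<lambda>G H. nat_copy (disjoint_union G H)"
proof -
  fix G G' H H' :: "(nat, nat, 't) fgraph"
  assume 1: "feynman_graph G \<and> feynman_graph G' \<and> G \<simeq> G'"
    and 2: "feynman_graph H \<and> feynman_graph H' \<and> H \<simeq> H'"
  have f: "feynman_graph (disjoint_union G H)" "feynman_graph (disjoint_union G' H')"
    using 1 2 by (auto intro: feynman_graph_disjoint_union)
  have "disjoint_union G H \<simeq> disjoint_union G' H'"
    using 1 2 by (auto intro: disjoint_union_cong)
  then show "feynman_graph (nat_copy (disjoint_union G H)) \<and>
      feynman_graph (nat_copy (disjoint_union G' H')) \<and>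
      nat_copy (disjoint_union G H) \<simeq> nat_copy (disjoint_union G' H')"
    by (rule nat_copy_cong[OF f])
qed

instance
proof
  fix a b c :: "'t igraph"
  show "a + b + c = a + (b + c)"
  proof (transfer, goal_cases)
    case (1 G H K)
    then have g: "feynman_graph G" "feynman_graph H" "feynman_graph K" by auto
    let ?GH = "disjoint_union G H" and ?HK = "disjoint_union H K"
    have fg: "feynman_graph ?GH" "feynman_graph ?HK"
      using g by (auto intro: feynman_graph_disjoint_union)
    have n: "feynman_graph (disjoint_union (nat_copy ?GH) K)"
        "feynman_graph (disjoint_union G (nat_copy ?HK))"
        "feynman_graph (disjoint_union ?GH K)" "feynman_graph (disjoint_union G ?HK)"
      using g fg nat_copy by (auto intro: feynman_graph_disjoint_union)
    have "disjoint_union (nat_copy ?GH) K \<simeq> disjoint_union ?GH K"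
      by (rule disjoint_union_cong) (use nat_copy fg isomorphic_sym in auto)
    moreover have "disjoint_union ?GH K \<simeq> disjoint_union G ?HK"
      by (rule disjoint_union_assoc)
    moreover have "disjoint_union G ?HK \<simeq> disjoint_union G (nat_copy ?HK)"
      by (rule disjoint_union_cong) (use nat_copy fg in auto)
    ultimately have "disjoint_union (nat_copy ?GH) K \<simeq> disjoint_union G (nat_copy ?HK)"
      using isomorphic_trans[OF n(1) isomorphic_trans[OF n(1)]] by blast
    then show ?case by (rule nat_copy_cong[OF n(1,2)])
  qed
  show "a + b = b + a"
  proof (transfer, goal_cases)
    case (1 G H)
    then have n: "feynman_graph (disjoint_union G H)" "feynman_graph (disjoint_union H G)"
      by (auto intro: feynman_graph_disjoint_union)
    then show ?case by (rule nat_copy_cong) (rule disjoint_union_commute)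
  qed
  show "0 + a = a"
  proof (transfer, goal_cases)
    case (1 G)
    then have n: "feynman_graph G"
      "feynman_graph (disjoint_union (empty_graph :: (nat, nat, 't) fgraph) G)"
      using feynman_graph_empty by (auto intro: feynman_graph_disjoint_union)
    let ?E = "disjoint_union (empty_graph :: (nat, nat, 't) fgraph) G"
    have "?E \<simeq> G" by (rule isomorphic_sym[OF n(1) disjoint_union_empty])
    then have "nat_copy ?E \<simeq> G"
      by (rule isomorphic_trans[OF nat_copy(1)[OF n(2)] isomorphic_sym[OF n(2) nat_copy(2)[OF n(2)]]])
    then show ?case using n nat_copy(1)[OF n(2)] by blast
  qed
qed

end

lemma iso_class_disjoint_union:
  assumes "feynman_graph G" "feynman_graph H"
  shows "iso_class G + iso_class H = iso_class (disjoint_union G H)"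
proof -
  note n = nat_copy[OF assms(1)] nat_copy[OF assms(2)]
  let ?D = "disjoint_union (nat_copy G) (nat_copy H)"
  have f: "feynman_graph ?D" "feynman_graph (disjoint_union G H)"
    using n assms by (auto intro: feynman_graph_disjoint_union)
  have "iso_class G + iso_class H = iso_class ?D"
    unfolding iso_class_def using n by (simp add: plus_igraph.abs_eq)
  also have "\<dots> = iso_class (disjoint_union G H)"
    unfolding iso_class_eq_iff[OF f]
    using disjoint_union_cong[OF n(2,4)] f isomorphic_sym by blast
  finally show ?thesis .
qed

lemma iso_class_empty: "iso_class (empty_graph :: ('v, 'h, 't) fgraph) = 0"
proof -
  have "iso_class (empty_graph :: ('v, 'h, 't) fgraph)
      = iso_class (empty_graph :: (nat, nat, 't) fgraph)"
    unfolding iso_class_eq_iff[OF feynman_graph_empty feynman_graph_empty]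
    by (auto simp: isomorphic_def is_iso_def empty_graph_def bij_betw_def)
  then show ?thesis by (simp add: iso_class_nat[OF feynman_graph_empty] zero_igraph.abs_eq)
qed

section \<open>Field theories\<close>

text \<open>
  \<open>E\<close> is the set of half-edge types and \<open>V\<close> the set of vertex types. A function on \<open>E\<close> is
  represented by its extension by zero to the whole type.
\<close>

locale field_theory =
  fixes E :: "'t set" and V :: "('t \<Rightarrow> nat) set"
  assumes vertex_type_support: "n \<in> V \<Longrightarrow> t \<notin> E \<Longrightarrow> n t = 0"

definition star :: "('v, 'h, 't) fgraph \<Rightarrow> 'v \<Rightarrow> 'h set" where
  "star G v = {e \<in> hedges G. att G e = v}"

definition vertex_type :: "('v, 'h, 't) fgraph \<Rightarrow> 'v \<Rightarrow> 't \<Rightarrow> nat" where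
  "vertex_type G v = (\<lambda>t. card {e \<in> star G v. htype G e = t})"

definition in_theory :: "'t set \<Rightarrow> ('t \<Rightarrow> nat) set \<Rightarrow> ('v, 'h, 't) fgraph \<Rightarrow> bool" where
  "in_theory E V G \<longleftrightarrow> (\<forall>e\<in>hedges G. htype G e \<in> E) \<and> (\<forall>v\<in>verts G. vertex_type G v \<in> V)"

definition residue_in_theory :: "('t \<Rightarrow> nat) set \<Rightarrow> ('v, 'h, 't) fgraph \<Rightarrow> bool" where
  "residue_in_theory V G \<longleftrightarrow> (\<exists>v. verts (residue G) = {v} \<and> vertex_type (residue G) v \<in> V)"

definition superficially_divergent :: "('t \<Rightarrow> nat) set \<Rightarrow> ('v, 'h, 't) fgraph \<Rightarrow> bool" where
  "superficially_divergent V G \<longleftrightarrow>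
     (\<forall>C\<in>components G. residue_in_theory V (restrict_verts G C))"

text \<open>
  These are the classes of the finite disjoint unions of connected 1PI superficially divergent
  graphs (the empty union included), so they form a basis of the free commutative algebra on the
  latter.
\<close>

definition divergent_classes :: "'t set \<Rightarrow> ('t \<Rightarrow> nat) set \<Rightarrow> 't igraph set" where
  "divergent_classes E V = {iso_class G | G :: (nat, nat, 't) fgraph.
     feynman_graph G \<and> in_theory E V G \<and> locally_1PI G \<and> superficially_divergent V G}"

section \<open>Invariance under isomorphism\<close>

lemma bij_betw_Collect_iff:
  assumes "bij_betw g A B" "\<And>e. e \<in> A \<Longrightarrow> Q (g e) \<longleftrightarrow> P e"
  shows "bij_betw g {e \<in> A. P e} {e \<in> B. Q e}"
proof (rule bij_betw_imageI)
  show "inj_on g {e \<in> A. P e}"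
    using assms(1) by (auto simp: bij_betw_def intro: inj_on_subset)
  have "B = g ` A" using assms(1) by (simp add: bij_betw_def)
  then show "g ` {e \<in> A. P e} = {e \<in> B. Q e}" using assms(2) by auto
qed

lemma conn_rel_subset: "conn_rel G \<subseteq> verts G \<times> verts G"
  by (auto simp: conn_rel_def)

lemma conn_rel_refl: "v \<in> verts G \<Longrightarrow> (v, v) \<in> conn_rel G"
  by (auto simp: conn_rel_def)

lemma components_image: "components G = (\<lambda>v. conn_rel G `` {v}) ` verts G"
  by (auto simp: components_def quotient_def)

lemma component_subset: "C \<in> components G \<Longrightarrow> C \<subseteq> verts G"
  using conn_rel_subset[of G] by (auto simp: components_image)

lemma iso_conn_rel:
  assumes "is_iso f g G H" "feynman_graph G" "(v, w) \<in> conn_rel G"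
  shows "(f v, f w) \<in> conn_rel H"
proof -
  note I = is_isoD[OF assms(1)] and F = feynman_graphD[OF assms(2)]
  have step: "(f x, f y) \<in> adjacent H" if xy: "(x, y) \<in> adjacent G" for x y
  proof -
    obtain e where e: "e \<in> hedges G" "invol G e \<noteq> e" "x = att G e" "y = att G (invol G e)"
      using xy by (auto simp: adjacent_def)
    then have "g (invol G e) \<noteq> g e"
      using I(2) F(3) by (metis bij_betw_imp_inj_on inj_on_eq_iff)
    then have "g e \<in> hedges H" "invol H (g e) \<noteq> g e"
        "f x = att H (g e)" "f y = att H (invol H (g e))"
      using e I F by auto
    then show ?thesis by (auto simp: adjacent_def)
  qed
  have vw: "v \<in> verts G" "w \<in> verts G" "(v, w) \<in> (adjacent G)\<^sup>*"
    using assms(3) by (auto simp: conn_rel_def)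
  from vw(3) have "(f v, f w) \<in> (adjacent H)\<^sup>*"
    by induction (use step in \<open>auto intro: rtrancl_into_rtrancl\<close>)
  then show ?thesis using vw I by (auto simp: conn_rel_def)
qed

lemma iso_conn_class:
  assumes iso: "is_iso f g G H" and G: "feynman_graph G" and v: "v \<in> verts G"
  shows "conn_rel H `` {f v} = f ` (conn_rel G `` {v})"
proof (intro subset_antisym subsetI)
  fix y assume "y \<in> conn_rel H `` {f v}"
  then have y: "(f v, y) \<in> conn_rel H" "y \<in> verts H" using conn_rel_subset by auto
  let ?i = "inv_into (verts G) f"
  have "(?i (f v), ?i y) \<in> conn_rel G"
    by (rule iso_conn_rel[OF iso_sym[OF G iso] iso_feynman_graph[OF G iso] y(1)])
  moreover have "?i (f v) = v" "f (?i y) = y"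
    using is_isoD(1)[OF iso] v y(2)
    by (simp_all add: bij_betw_inv_into_left bij_betw_inv_into_right)
  ultimately show "y \<in> f ` (conn_rel G `` {v})" by (metis Image_singleton_iff image_eqI)
qed (use iso_conn_rel[OF iso G] in auto)

lemma iso_components:
  assumes "is_iso f g G H" "feynman_graph G"
  shows "components H = (`) f ` components G"
proof -
  have "verts H = f ` verts G" using is_isoD(1)[OF assms(1)] by (simp add: bij_betw_def)
  then show ?thesis
    by (simp add: components_image image_image iso_conn_class[OF assms] cong: image_cong)
qed

lemma iso_bij_components:
  assumes "is_iso f g G H" "feynman_graph G"
  shows "bij_betw ((`) f) (components G) (components H)"
proof -
  have "inj_on f (\<Union> (components G))"
    using is_isoD(1)[OF assms(1)] component_subset
    by (metis Sup_least bij_betw_imp_inj_on inj_on_subset)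
  then show ?thesis
    using iso_components[OF assms] by (auto simp: bij_betw_def intro: inj_on_image)
qed

lemma iso_connected:
  assumes "is_iso f g G H" "feynman_graph G" "connected_graph G"
  shows "connected_graph H"
  using bij_betw_same_card[OF iso_bij_components[OF assms(1,2)]] assms(3)
  by (simp add: connected_graph_def)

lemma feynman_graph_cut:
  "feynman_graph G \<Longrightarrow> e \<in> hedges G \<Longrightarrow> feynman_graph (cut e G)"
  unfolding feynman_graph_def cut_def by (auto; metis)

lemma iso_cut:
  assumes iso: "is_iso f g G H" and G: "feynman_graph G" and e: "e \<in> hedges G"
  shows "is_iso f g (cut e G) (cut (g e) H)"
proof -
  note I = is_isoD[OF iso] and F = feynman_graphD[OF G]
  have inj: "g a = g b \<longleftrightarrow> a = b" if "a \<in> hedges G" "b \<in> hedges G" for a b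
    using I(2) that by (metis bij_betw_imp_inj_on inj_on_eq_iff)
  show ?thesis using I e F(3) by (simp add: is_iso_def cut_def inj)
qed

lemma iso_one_PI:
  assumes "is_iso f g G H" "feynman_graph G" "one_PI G"
  shows "one_PI H"
proof -
  note I = is_isoD[OF assms(1)]
  have "connected_graph (cut e' H)" if e': "e' \<in> hedges H" "invol H e' \<noteq> e'" for e'
  proof -
    obtain e where e: "e \<in> hedges G" "e' = g e"
      using I(2) e'(1) by (auto simp: bij_betw_def)
    then have "invol G e \<noteq> e" using e'(2) I by auto
    then show ?thesis
      using iso_connected[OF iso_cut[OF assms(1,2) e(1)] feynman_graph_cut[OF assms(2) e(1)]]
        assms(3) e by (auto simp: one_PI_def)
  qed
  then show ?thesis
    using iso_connected[OF assms(1,2)] assms(3) by (auto simp: one_PI_def)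
qed

lemma component_invol:
  assumes "feynman_graph G" "C \<in> components G" "e \<in> hedges G" "att G e \<in> C"
  shows "att G (invol G e) \<in> C"
proof (cases "invol G e = e")
  case False
  note F = feynman_graphD[OF assms(1)]
  obtain v where v: "v \<in> verts G" "C = conn_rel G `` {v}"
    using assms(2) by (auto simp: components_def quotient_def)
  have "(att G e, att G (invol G e)) \<in> adjacent G"
    using False assms(3) by (auto simp: adjacent_def)
  then show ?thesis
    using v assms(3,4) F by (auto simp: conn_rel_def intro: rtrancl_into_rtrancl)
qed (use assms in simp)

lemma feynman_graph_component:
  assumes "feynman_graph G" "C \<in> components G"
  shows "feynman_graph (restrict_verts G C)"
  using feynman_graphD[OF assms(1)] component_invol[OF assms] component_subset[OF assms(2)]
  by (auto simp: feynman_graph_def restrict_verts_def intro: finite_subset)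

lemma iso_restrict:
  assumes iso: "is_iso f g G H" and G: "feynman_graph G" and C: "C \<subseteq> verts G"
  shows "is_iso f g (restrict_verts G C) (restrict_verts H (f ` C))"
proof -
  note I = is_isoD[OF iso] and F = feynman_graphD[OF G]
  have "bij_betw f C (f ` C)"
    using I(1) C by (metis bij_betw_subset)
  moreover have "f (att G e) \<in> f ` C \<longleftrightarrow> att G e \<in> C" if "e \<in> hedges G" for e
    using I(1) C F(5)[OF that] by (metis bij_betw_imp_inj_on inj_on_image_mem_iff)
  then have "bij_betw g {e \<in> hedges G. att G e \<in> C} {e \<in> hedges H. att H e \<in> f ` C}"
    using I(4) by (intro bij_betw_Collect_iff[OF I(2)]) simp
  ultimately show ?thesis using I by (simp add: is_iso_def restrict_verts_def)
qed

lemma iso_locally_1PI: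
  assumes "is_iso f g G H" "feynman_graph G" "locally_1PI G"
  shows "locally_1PI H"
  unfolding locally_1PI_def iso_components[OF assms(1,2)]
  using assms(3) iso_one_PI[OF iso_restrict[OF assms(1,2) component_subset]
      feynman_graph_component[OF assms(2)]]
  by (auto simp: locally_1PI_def)

lemma iso_vertex_type:
  assumes "is_iso f g G H" "feynman_graph G" "v \<in> verts G"
  shows "vertex_type H (f v) = vertex_type G v"
proof
  fix t
  note I = is_isoD[OF assms(1)] and F = feynman_graphD[OF assms(2)]
  have "f (att G e) = f v \<longleftrightarrow> att G e = v" if "e \<in> hedges G" for e
    using I(1) F(5)[OF that] assms(3) by (metis bij_betw_imp_inj_on inj_on_eq_iff)
  then have "bij_betw g {e \<in> hedges G. att G e = v \<and> htype G e = t}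
      {e \<in> hedges H. att H e = f v \<and> htype H e = t}"
    using I(4,5) by (intro bij_betw_Collect_iff[OF I(2)]) simp
  then show "vertex_type H (f v) t = vertex_type G v t"
    by (simp add: vertex_type_def star_def bij_betw_same_card)
qed

lemma iso_in_theory:
  assumes "is_iso f g G H" "feynman_graph G" "in_theory E V G"
  shows "in_theory E V H"
proof -
  have "verts H = f ` verts G" "hedges H = g ` hedges G"
    using is_isoD(1,2)[OF assms(1)] by (simp_all add: bij_betw_def)
  then show ?thesis
    using assms(3) iso_vertex_type[OF assms(1,2)] is_isoD(5)[OF assms(1)]
    by (auto simp: in_theory_def)
qed

lemma covering_subgraphD:
  assumes "\<gamma> \<in> covering_subgraphs G"
  shows "verts \<gamma> = verts G" "hedges \<gamma> = hedges G" "att \<gamma> = att G" "htype \<gamma> = htype G"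
    "e \<notin> hedges G \<Longrightarrow> invol \<gamma> e = invol G e"
    "e \<in> hedges G \<Longrightarrow> invol \<gamma> e = e \<or> invol \<gamma> e = invol G e"
    "e \<in> hedges G \<Longrightarrow> invol \<gamma> e = e \<Longrightarrow> invol \<gamma> (invol G e) = invol G e"
    "G\<lparr>invol := invol \<gamma>\<rparr> = \<gamma>"
  using assms by (auto simp: covering_subgraphs_def)

lemma feynman_graph_covering:
  assumes "feynman_graph G" "\<gamma> \<in> covering_subgraphs G"
  shows "feynman_graph \<gamma>"
proof -
  note F = feynman_graphD[OF assms(1)] and C = covering_subgraphD[OF assms(2)]
  have "invol \<gamma> (invol \<gamma> e) = e" if e: "e \<in> hedges G" for e
  proof (cases "invol \<gamma> e = e")
    case False
    then have e1: "invol \<gamma> e = invol G e" "invol G e \<noteq> e" using C(6)[OF e] by auto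
    have "invol \<gamma> (invol G e) = invol G e \<Longrightarrow> invol \<gamma> e = e"
      using C(7)[OF F(3)[OF e]] F(4)[OF e] by simp
    then show ?thesis using C(6)[OF F(3)[OF e]] e1 F(4)[OF e] by auto
  qed simp
  moreover have "invol \<gamma> e \<in> hedges G \<and> htype G (invol \<gamma> e) = htype G e" if e: "e \<in> hedges G" for e
    using C(6)[OF e] e F by auto
  ultimately show ?thesis using F C(1-4) by (auto simp: feynman_graph_def)
qed

lemma finite_covering_subgraphs:
  assumes "feynman_graph G"
  shows "finite (covering_subgraphs G)"
proof -
  let ?f = "\<lambda>X. G\<lparr>invol := (\<lambda>e. if e \<in> X then e else invol G e)\<rparr>"
  have "\<gamma> \<in> ?f ` Pow (hedges G)" if "\<gamma> \<in> covering_subgraphs G" for \<gamma>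
  proof -
    note C = covering_subgraphD[OF that]
    have "invol \<gamma> = (\<lambda>e. if e \<in> {e \<in> hedges G. invol \<gamma> e = e} then e else invol G e)"
      by (rule ext) (use C(5,6) in auto)
    then have "\<gamma> = ?f {e \<in> hedges G. invol \<gamma> e = e}" using C(8) by metis
    then show ?thesis by blast
  qed
  then show ?thesis
    using feynman_graphD(2)[OF assms] by (meson finite_Pow_iff finite_imageI finite_subset subsetI)
qed

lemma feynman_graph_contract:
  assumes "feynman_graph G" "\<gamma> \<in> covering_subgraphs G"
  shows "feynman_graph (contract G \<gamma>)"
proof -
  note F = feynman_graphD[OF assms(1)] and C = covering_subgraphD[OF assms(2)]
  have "finite (components \<gamma>)"
    using F(1) C(1) component_subset by (metis Pow_iff finite_Pow_iff finite_subset subsetI)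
  then show ?thesis using F C(1-4,7)
    by (auto simp: feynman_graph_def contract_def components_def intro: quotientI)
qed

definition transport_subgraph ::
  "('h \<Rightarrow> 'k) \<Rightarrow> ('v, 'h, 't) fgraph \<Rightarrow> ('w, 'k, 't) fgraph \<Rightarrow> ('v, 'h, 't) fgraph \<Rightarrow>
   ('w, 'k, 't) fgraph" where
  "transport_subgraph g G H \<gamma> = H\<lparr>invol := (\<lambda>e. if e \<in> hedges H
     then g (invol \<gamma> (inv_into (hedges G) g e)) else invol H e)\<rparr>"

lemma transport_subgraph:
  assumes iso: "is_iso f g G H" and G: "feynman_graph G" and \<gamma>: "\<gamma> \<in> covering_subgraphs G"
  shows "transport_subgraph g G H \<gamma> \<in> covering_subgraphs H"
    and "is_iso f g \<gamma> (transport_subgraph g G H \<gamma>)"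
    and "is_iso ((`) f) g (contract G \<gamma>) (contract H (transport_subgraph g G H \<gamma>))"
proof -
  note I = is_isoD[OF iso] and F = feynman_graphD[OF G] and C = covering_subgraphD[OF \<gamma>]
  let ?T = "transport_subgraph g G H \<gamma>"
  have T: "invol ?T (g e) = g (invol \<gamma> e)" if "e \<in> hedges G" for e
    using I(2) I(7)[OF that] that by (simp add: transport_subgraph_def bij_betw_inv_into_left)
  have inj: "g a = g b \<longleftrightarrow> a = b" if "a \<in> hedges G" "b \<in> hedges G" for a b
    using I(2) that by (metis bij_betw_imp_inj_on inj_on_eq_iff)
  have C': "invol \<gamma> e \<in> hedges G" if "e \<in> hedges G" for e
    using C(6)[OF that] that F(3) by auto
  have sel: "verts ?T = verts H" "hedges ?T = hedges H" "att ?T = att H" "htype ?T = htype H"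
    by (simp_all add: transport_subgraph_def)
  have "invol ?T e' \<in> {e', invol H e'} \<and> (invol ?T e' = e' \<longrightarrow> invol ?T (invol H e') = invol H e')"
    if e': "e' \<in> hedges H" for e'
  proof -
    obtain e where e: "e \<in> hedges G" "e' = g e"
      using I(2) e' by (auto simp: bij_betw_def)
    then show ?thesis using T C(6,7) F(3) C' inj I(3) by auto
  qed
  moreover have "invol ?T e = invol H e" if "e \<notin> hedges H" for e
    using that by (simp add: transport_subgraph_def)
  moreover have "?T = H\<lparr>invol := invol ?T\<rparr>" by (simp add: transport_subgraph_def)
  ultimately show "?T \<in> covering_subgraphs H" unfolding covering_subgraphs_def by blast
  show iso': "is_iso f g \<gamma> ?T"
    using I T C(1-4) by (simp add: is_iso_def sel)
  have g\<gamma>: "feynman_graph \<gamma>" by (rule feynman_graph_covering[OF G \<gamma>])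
  have "bij_betw g {e \<in> hedges G. invol \<gamma> e = e} {e \<in> hedges H. invol ?T e = e}"
    using T inj C' by (intro bij_betw_Collect_iff[OF I(2)]) simp
  then show "is_iso ((`) f) g (contract G \<gamma>) (contract H ?T)"
    using iso_bij_components[OF iso' g\<gamma>] iso_conn_class[OF iso' g\<gamma>] I F C(1)
    by (simp add: is_iso_def contract_def)
qed

lemma transport_subgraph_inverse:
  assumes iso: "is_iso f g G H" and G: "feynman_graph G"
  shows "\<gamma> \<in> covering_subgraphs G \<Longrightarrow>
      transport_subgraph (inv_into (hedges G) g) H G (transport_subgraph g G H \<gamma>) = \<gamma>"
    and "\<gamma>' \<in> covering_subgraphs H \<Longrightarrow>
      transport_subgraph g G H (transport_subgraph (inv_into (hedges G) g) H G \<gamma>') = \<gamma>'"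
proof -
  note I = is_isoD[OF iso]
  note b = bij_betw_inv_into_left[OF I(2)] bij_betw_inv_into_right[OF I(2)]
    inv_into_inv_into_eq[OF I(2)]
  have H: "feynman_graph H" by (rule iso_feynman_graph[OF G iso])
  have im: "inv_into (hedges G) g e \<in> hedges G" if "e \<in> hedges H" for e
    using I(2) that by (metis bij_betwE bij_betw_inv_into)
  show "transport_subgraph (inv_into (hedges G) g) H G (transport_subgraph g G H \<gamma>) = \<gamma>"
    if \<gamma>: "\<gamma> \<in> covering_subgraphs G"
  proof -
    note C = covering_subgraphD[OF \<gamma>] and F = feynman_graphD[OF feynman_graph_covering[OF G \<gamma>]]
    have "invol (transport_subgraph (inv_into (hedges G) g) H G (transport_subgraph g G H \<gamma>)) = invol \<gamma>"
      using C(2,5) F(3) I(7) by (auto simp: transport_subgraph_def b fun_eq_iff)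
    then show ?thesis using C(8) unfolding transport_subgraph_def by simp
  qed
  show "transport_subgraph g G H (transport_subgraph (inv_into (hedges G) g) H G \<gamma>') = \<gamma>'"
    if \<gamma>: "\<gamma>' \<in> covering_subgraphs H"
  proof -
    note C = covering_subgraphD[OF \<gamma>] and F = feynman_graphD[OF feynman_graph_covering[OF H \<gamma>]]
    have "invol (transport_subgraph g G H (transport_subgraph (inv_into (hedges G) g) H G \<gamma>')) = invol \<gamma>'"
      using C(2,5) F(3) im by (auto simp: transport_subgraph_def b fun_eq_iff)
    then show ?thesis using C(8) unfolding transport_subgraph_def by simp
  qed
qed
section \<open>Vector spaces with a basis and their tensor products\<close>

text \<open>
  Vectors are finitely supported functions. With a commutative monoid as index type the
  multiplication of \<^typ>\<open>'b \<Rightarrow>\<^sub>0 'k\<close> is that of the monoid algebra, and with a product of monoids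
  it is the multiplication \<open>(a \<otimes> b)(c \<otimes> d) = ac \<otimes> bd\<close> of the tensor product (lemma
  \<open>tensor_mult\<close> below).
\<close>

definition scale :: "'k::field \<Rightarrow> ('b \<Rightarrow>\<^sub>0 'k) \<Rightarrow> ('b \<Rightarrow>\<^sub>0 'k)" where
  "scale c p = Poly_Mapping.map ((*) c) p"

definition free_space :: "'b set \<Rightarrow> ('b \<Rightarrow>\<^sub>0 'k::field) set" where
  "free_space B = {p. Poly_Mapping.keys p \<subseteq> B}"

abbreviation basis_vector :: "'b \<Rightarrow> ('b \<Rightarrow>\<^sub>0 'k::field)" where
  "basis_vector x \<equiv> Poly_Mapping.single x 1"

definition linear_on ::
  "('b \<Rightarrow>\<^sub>0 'k::field) set \<Rightarrow> ('k \<Rightarrow> 'w \<Rightarrow> 'w::ab_group_add) \<Rightarrow> (('b \<Rightarrow>\<^sub>0 'k) \<Rightarrow> 'w) \<Rightarrow> bool" where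
  "linear_on S s f \<longleftrightarrow> (\<forall>p\<in>S. \<forall>q\<in>S. f (p + q) = f p + f q) \<and>
     (\<forall>c. \<forall>p\<in>S. f (scale c p) = s c (f p))"

text \<open>The linear map, into a space with scalar multiplication \<open>s\<close>, with given values on the basis.\<close>

definition linear_extension ::
  "('k::field \<Rightarrow> 'w \<Rightarrow> 'w::ab_group_add) \<Rightarrow> ('b \<Rightarrow> 'w) \<Rightarrow> ('b \<Rightarrow>\<^sub>0 'k) \<Rightarrow> 'w" where
  "linear_extension s f p = (\<Sum>x\<in>Poly_Mapping.keys p. s (Poly_Mapping.lookup p x) (f x))"

text \<open>
  The tensor product of \<open>free_space B\<close> and \<open>free_space C\<close> is \<open>free_space (B \<times> C)\<close>; see lemma
  \<open>tensor_universal\<close> for its universal property.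
\<close>

definition tensor :: "('b \<Rightarrow>\<^sub>0 'k::field) \<Rightarrow> ('c \<Rightarrow>\<^sub>0 'k) \<Rightarrow> ('b \<times> 'c \<Rightarrow>\<^sub>0 'k)" where
  "tensor p q = (\<Sum>x\<in>Poly_Mapping.keys p. \<Sum>y\<in>Poly_Mapping.keys q. Poly_Mapping.single (x, y) (Poly_Mapping.lookup p x * Poly_Mapping.lookup q y))"

definition tensor_map ::
  "(('b \<Rightarrow>\<^sub>0 'k::field) \<Rightarrow> ('d \<Rightarrow>\<^sub>0 'k)) \<Rightarrow> (('c \<Rightarrow>\<^sub>0 'k) \<Rightarrow> ('e \<Rightarrow>\<^sub>0 'k)) \<Rightarrow>
   ('b \<times> 'c \<Rightarrow>\<^sub>0 'k) \<Rightarrow> ('d \<times> 'e \<Rightarrow>\<^sub>0 'k)" where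
  "tensor_map f g =
     linear_extension scale (\<lambda>(x, y). tensor (f (basis_vector x)) (g (basis_vector y)))"

definition tensor_assoc :: "(('b \<times> 'c) \<times> 'd \<Rightarrow>\<^sub>0 'k::field) \<Rightarrow> ('b \<times> 'c \<times> 'd \<Rightarrow>\<^sub>0 'k)" where
  "tensor_assoc = linear_extension scale (\<lambda>((x, y), z). basis_vector (x, y, z))"

text \<open>
  \<open>f \<otimes> id\<close> and \<open>id \<otimes> f\<close> for a linear form \<open>f\<close>, with the tensor product of the base field and a
  space identified with that space.
\<close>

definition form_left :: "(('b \<Rightarrow>\<^sub>0 'k::field) \<Rightarrow> 'k) \<Rightarrow> ('b \<times> 'c \<Rightarrow>\<^sub>0 'k) \<Rightarrow> ('c \<Rightarrow>\<^sub>0 'k)" where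
  "form_left f = linear_extension scale (\<lambda>(x, y). scale (f (basis_vector x)) (basis_vector y))"

definition form_right :: "(('c \<Rightarrow>\<^sub>0 'k::field) \<Rightarrow> 'k) \<Rightarrow> ('b \<times> 'c \<Rightarrow>\<^sub>0 'k) \<Rightarrow> ('b \<Rightarrow>\<^sub>0 'k)" where
  "form_right f = linear_extension scale (\<lambda>(x, y). scale (f (basis_vector y)) (basis_vector x))"

subsection \<open>Bialgebras\<close>

locale coalgebra =
  fixes B :: "'b set"
    and \<Delta> :: "('b \<Rightarrow>\<^sub>0 'k::field) \<Rightarrow> ('b \<times> 'b \<Rightarrow>\<^sub>0 'k)"
    and \<epsilon> :: "('b \<Rightarrow>\<^sub>0 'k) \<Rightarrow> 'k"
  assumes comult_linear: "linear_on (free_space B) scale \<Delta>"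
    and comult_closed: "a \<in> free_space B \<Longrightarrow> \<Delta> a \<in> free_space (B \<times> B)"
    and counit_linear: "linear_on (free_space B) (*) \<epsilon>"
    and coassoc: "a \<in> free_space B \<Longrightarrow>
      tensor_assoc (tensor_map \<Delta> id (\<Delta> a)) = tensor_map id \<Delta> (\<Delta> a)"
    and counit_left: "a \<in> free_space B \<Longrightarrow> form_left \<epsilon> (\<Delta> a) = a"
    and counit_right: "a \<in> free_space B \<Longrightarrow> form_right \<epsilon> (\<Delta> a) = a"

text \<open>
  Associativity, the unit laws and bilinearity of the multiplication hold in the whole monoid
  algebra; \<open>free_space B\<close> has to be a subalgebra.
\<close>

locale bialgebra = coalgebra B \<Delta> \<epsilon>
  for B :: "'b::comm_monoid_add set"
    and \<Delta> :: "('b \<Rightarrow>\<^sub>0 'k::field) \<Rightarrow> ('b \<times> 'b \<Rightarrow>\<^sub>0 'k)"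
    and \<epsilon> :: "('b \<Rightarrow>\<^sub>0 'k) \<Rightarrow> 'k" +
  assumes one_closed: "(1 :: 'b \<Rightarrow>\<^sub>0 'k) \<in> free_space B"
    and mult_closed: "a \<in> free_space B \<Longrightarrow> b \<in> free_space B \<Longrightarrow> a * b \<in> free_space B"
    and comult_one: "\<Delta> 1 = 1"
    and comult_mult: "a \<in> free_space B \<Longrightarrow> b \<in> free_space B \<Longrightarrow> \<Delta> (a * b) = \<Delta> a * \<Delta> b"
    and counit_one: "\<epsilon> 1 = 1"
    and counit_mult: "a \<in> free_space B \<Longrightarrow> b \<in> free_space B \<Longrightarrow> \<epsilon> (a * b) = \<epsilon> a * \<epsilon> b"

subsection \<open>Basic properties\<close>

lemma lookup_scale [simp]: "Poly_Mapping.lookup (scale c p) x = c * Poly_Mapping.lookup p x"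
  unfolding scale_def by transfer (simp add: when_def)

lemma scale_single [simp]: "scale c (Poly_Mapping.single x a) = Poly_Mapping.single x (c * a)"
  by (rule poly_mapping_eqI) (simp add: lookup_single when_def)

global_interpretation scale: vector_space "scale :: 'k::field \<Rightarrow> ('b \<Rightarrow>\<^sub>0 'k) \<Rightarrow> 'b \<Rightarrow>\<^sub>0 'k"
  by unfold_locales (auto intro!: poly_mapping_eqI simp: lookup_add algebra_simps)

lemma in_free_space_iff: "p \<in> free_space B \<longleftrightarrow> (\<forall>x. x \<notin> B \<longrightarrow> Poly_Mapping.lookup p x = 0)"
  by (auto simp: free_space_def in_keys_iff)

lemma subspace_free_space: "scale.subspace (free_space B)"
  by (auto simp: scale.subspace_def in_free_space_iff lookup_add)

lemma sum_basis:
  fixes p :: "'b \<Rightarrow>\<^sub>0 'k::field"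
  shows "(\<Sum>x\<in>Poly_Mapping.keys p. scale (Poly_Mapping.lookup p x) (basis_vector x)) = p"
  by (rule poly_mapping_eqI)
    (auto simp: lookup_sum lookup_single when_def sum.delta in_keys_iff)

lemma free_space_eq_span:
  fixes B :: "'b set"
  shows "(free_space B :: ('b \<Rightarrow>\<^sub>0 'k::field) set) = scale.span (basis_vector ` B)"
proof
  show "(free_space B :: ('b \<Rightarrow>\<^sub>0 'k) set) \<subseteq> scale.span (basis_vector ` B)"
  proof
    fix p :: "'b \<Rightarrow>\<^sub>0 'k" assume "p \<in> free_space B"
    then have "(\<Sum>x\<in>Poly_Mapping.keys p. scale (Poly_Mapping.lookup p x) (basis_vector x)) \<in> scale.span (basis_vector ` B)"
      by (intro scale.span_sum scale.span_scale scale.span_base) (auto simp: free_space_def)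
    then show "p \<in> scale.span (basis_vector ` B)" by (simp only: sum_basis)
  qed
  show "scale.span (basis_vector ` B) \<subseteq> (free_space B :: ('b \<Rightarrow>\<^sub>0 'k) set)"
    by (rule scale.span_minimal[OF _ subspace_free_space]) (auto simp: free_space_def)
qed

lemma linear_on_extension:
  fixes h :: "('b \<Rightarrow>\<^sub>0 'k::field) \<Rightarrow> 'w::ab_group_add"
  assumes "linear_on (free_space B) s h" "vector_space s" "p \<in> free_space B"
  shows "h p = linear_extension s (\<lambda>x. h (basis_vector x)) p"
proof -
  interpret s: vector_space s by fact
  note L = assms(1)[unfolded linear_on_def]
  have zero: "0 \<in> free_space B" by (simp add: in_free_space_iff)
  have "h (scale 0 0) = s 0 (h 0)" using L zero by blast
  then have h0: "h 0 = 0" by simp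
  have "finite X \<Longrightarrow> X \<subseteq> B \<Longrightarrow>
      (\<Sum>x\<in>X. scale (Poly_Mapping.lookup p x) (basis_vector x)) \<in> free_space B \<and>
      h (\<Sum>x\<in>X. scale (Poly_Mapping.lookup p x) (basis_vector x)) = (\<Sum>x\<in>X. s (Poly_Mapping.lookup p x) (h (basis_vector x)))" for X
  proof (induction X rule: finite_induct)
    case empty
    then show ?case using h0 zero by simp
  next
    case (insert y X)
    let ?r = "\<Sum>x\<in>X. scale (Poly_Mapping.lookup p x) (basis_vector x)"
    let ?y = "scale (Poly_Mapping.lookup p y) (basis_vector y)"
    have IH: "?r \<in> free_space B" "h ?r = (\<Sum>x\<in>X. s (Poly_Mapping.lookup p x) (h (basis_vector x)))"
      using insert by auto
    have bv: "(basis_vector y :: 'b \<Rightarrow>\<^sub>0 'k) \<in> free_space B"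
      using insert.prems by (simp add: free_space_def)
    then have y: "?y \<in> free_space B" by (rule scale.subspace_scale[OF subspace_free_space])
    have "h (?y + ?r) = h ?y + h ?r" using L y IH(1) by blast
    moreover have "h ?y = s (Poly_Mapping.lookup p y) (h (basis_vector y))" using L bv by blast
    ultimately show ?case
      using insert.hyps IH scale.subspace_add[OF subspace_free_space y IH(1)]
      by (simp only: sum.insert) simp
  qed
  from this[of "Poly_Mapping.keys p"] show ?thesis
    using assms(3) by (simp only: sum_basis linear_extension_def free_space_def) simp
qed

lemma linear_extension_superset:
  assumes "vector_space s" "finite X" "Poly_Mapping.keys p \<subseteq> X"
  shows "linear_extension s f p = (\<Sum>x\<in>X. s (Poly_Mapping.lookup p x) (f x))"
proof -
  interpret s: vector_space s by fact
  show ?thesis unfolding linear_extension_def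
    by (rule sum.mono_neutral_left) (use assms(2,3) in \<open>auto simp: in_keys_iff\<close>)
qed

lemma linear_extension_add:
  assumes "vector_space s"
  shows "linear_extension s f (p + q) = linear_extension s f p + linear_extension s f q"
proof -
  interpret s: vector_space s by fact
  note sup = linear_extension_superset[OF assms, of "Poly_Mapping.keys p \<union> Poly_Mapping.keys q"]
  show ?thesis using keys_add[of p q]
    by (simp add: sup lookup_add s.scale_left_distrib sum.distrib)
qed

lemma linear_extension_scale:
  assumes "vector_space s"
  shows "linear_extension s f (scale c p) = s c (linear_extension s f p)"
proof -
  interpret s: vector_space s by fact
  have "Poly_Mapping.keys (scale c p) \<subseteq> Poly_Mapping.keys p" by (auto simp: in_keys_iff)
  then show ?thesis
    using linear_extension_superset[OF assms finite_keys, of "scale c p" p f]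
    by (simp add: linear_extension_def s.scale_sum_right)
qed

lemma linear_on_linear_extension:
  "vector_space s \<Longrightarrow> linear_on S s (linear_extension s f)"
  by (simp add: linear_on_def linear_extension_add linear_extension_scale)

lemma linear_extension_basis:
  assumes "vector_space s"
  shows "linear_extension s f (basis_vector x) = f x"
proof -
  interpret s: vector_space s by fact
  show ?thesis by (simp add: linear_extension_def)
qed

lemma lookup_tensor: "Poly_Mapping.lookup (tensor p q) (x, y) = Poly_Mapping.lookup p x * Poly_Mapping.lookup q y"
proof -
  have "Poly_Mapping.lookup (tensor p q) (x, y)
    = (\<Sum>u\<in>Poly_Mapping.keys p. \<Sum>v\<in>Poly_Mapping.keys q. (if u = x then if v = y then Poly_Mapping.lookup p x * Poly_Mapping.lookup q y else 0 else 0))"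
    by (auto simp: tensor_def lookup_sum lookup_single when_def intro!: sum.cong)
  also have "\<dots> = (\<Sum>u\<in>Poly_Mapping.keys p. if u = x then \<Sum>v\<in>Poly_Mapping.keys q. (if v = y then Poly_Mapping.lookup p x * Poly_Mapping.lookup q y else 0) else 0)"
    by (intro sum.cong) auto
  also have "\<dots> = Poly_Mapping.lookup p x * Poly_Mapping.lookup q y"
    by (simp add: sum.delta in_keys_iff)
  finally show ?thesis .
qed

lemma tensor_add_left: "tensor (p + p') q = tensor p q + tensor p' q"
  by (rule poly_mapping_eqI) (auto simp: lookup_tensor lookup_add algebra_simps split_paired_all)

lemma tensor_add_right: "tensor p (q + q') = tensor p q + tensor p q'"
  by (rule poly_mapping_eqI) (auto simp: lookup_tensor lookup_add algebra_simps split_paired_all)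

lemma tensor_scale_left: "tensor (scale c p) q = scale c (tensor p q)"
  by (rule poly_mapping_eqI) (auto simp: lookup_tensor split_paired_all)

lemma tensor_scale_right: "tensor p (scale c q) = scale c (tensor p q)"
  by (rule poly_mapping_eqI) (auto simp: lookup_tensor split_paired_all)

lemma tensor_single [simp]:
  "tensor (Poly_Mapping.single x a) (Poly_Mapping.single y b) = Poly_Mapping.single (x, y) (a * b)"
  by (rule poly_mapping_eqI) (auto simp: lookup_tensor lookup_single when_def split_paired_all)

lemma lookup_tensor': "Poly_Mapping.lookup (tensor p q) z =
    Poly_Mapping.lookup p (fst z) * Poly_Mapping.lookup q (snd z)"
  by (cases z) (simp add: lookup_tensor)

lemma keys_tensor: "Poly_Mapping.keys (tensor p q) = Poly_Mapping.keys p \<times> Poly_Mapping.keys q"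
  by (auto simp: in_keys_iff lookup_tensor)

lemma tensor_universal:
  fixes s :: "'k::field \<Rightarrow> 'w \<Rightarrow> 'w::ab_group_add"
  assumes s: "vector_space s"
    and left: "\<And>b. b \<in> free_space C \<Longrightarrow> linear_on (free_space B) s (\<lambda>a. \<beta> a b)"
    and right: "\<And>a. a \<in> free_space B \<Longrightarrow> linear_on (free_space C) s (\<beta> a)"
  shows "\<exists>h. linear_on (free_space (B \<times> C)) s h \<and>
      (\<forall>a\<in>free_space B. \<forall>b\<in>free_space C. h (tensor a b) = \<beta> a b)"
    and "\<lbrakk>linear_on (free_space (B \<times> C)) s h; linear_on (free_space (B \<times> C)) s h';
      \<And>a b. a \<in> free_space B \<Longrightarrow> b \<in> free_space C \<Longrightarrow> h (tensor a b) = h' (tensor a b);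
      u \<in> free_space (B \<times> C)\<rbrakk> \<Longrightarrow> h u = h' u"
proof -
  interpret s: vector_space s by fact
  let ?h = "linear_extension s (\<lambda>(x, y). \<beta> (basis_vector x) (basis_vector y))"
  have "?h (tensor a b) = \<beta> a b" if a: "a \<in> free_space B" and b: "b \<in> free_space C" for a b
  proof -
    have ab: "Poly_Mapping.keys a \<subseteq> B" "Poly_Mapping.keys b \<subseteq> C" using a b by (auto simp: free_space_def)
    have "\<beta> a b = (\<Sum>x\<in>Poly_Mapping.keys a. s (Poly_Mapping.lookup a x) (\<beta> (basis_vector x) b))"
      using linear_on_extension[OF left[OF b] s a] by (simp add: linear_extension_def)
    also have "\<dots> = (\<Sum>x\<in>Poly_Mapping.keys a. s (Poly_Mapping.lookup a x)
        (\<Sum>y\<in>Poly_Mapping.keys b. s (Poly_Mapping.lookup b y) (\<beta> (basis_vector x) (basis_vector y))))"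
    proof (rule sum.cong[OF refl])
      fix x assume "x \<in> Poly_Mapping.keys a"
      then have "basis_vector x \<in> free_space B" using ab by (auto simp: free_space_def)
      from linear_on_extension[OF right[OF this] s b]
      show "s (Poly_Mapping.lookup a x) (\<beta> (basis_vector x) b) = s (Poly_Mapping.lookup a x)
          (\<Sum>y\<in>Poly_Mapping.keys b. s (Poly_Mapping.lookup b y) (\<beta> (basis_vector x) (basis_vector y)))"
        by (simp add: linear_extension_def)
    qed
    also have "\<dots> = ?h (tensor a b)"
      by (simp add: linear_extension_def keys_tensor lookup_tensor' s.scale_sum_right
          sum.cartesian_product case_prod_unfold)
    finally show ?thesis by simp
  qed
  then show "\<exists>h. linear_on (free_space (B \<times> C)) s h \<and>
      (\<forall>a\<in>free_space B. \<forall>b\<in>free_space C. h (tensor a b) = \<beta> a b)"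
    using linear_on_linear_extension[OF s] by blast
  show "h u = h' u"
    if h: "linear_on (free_space (B \<times> C)) s h" "linear_on (free_space (B \<times> C)) s h'"
      and eq: "\<And>a b. a \<in> free_space B \<Longrightarrow> b \<in> free_space C \<Longrightarrow> h (tensor a b) = h' (tensor a b)"
      and u: "u \<in> free_space (B \<times> C)" for h h' u
  proof -
    have "h (basis_vector z) = h' (basis_vector z)" if zu: "z \<in> Poly_Mapping.keys u" for z
    proof -
      obtain x y where z: "z = (x, y)" "x \<in> B" "y \<in> C"
        using zu u by (auto simp: free_space_def)
      then show ?thesis
        using eq[of "basis_vector x" "basis_vector y"] by (simp add: free_space_def)
    qed
    then show ?thesis
      unfolding linear_on_extension[OF h(1) s u] linear_on_extension[OF h(2) s u]
      by (simp add: linear_extension_def)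
  qed
qed

lemma tensor_map_tensor:
  fixes f :: "('b \<Rightarrow>\<^sub>0 'k::field) \<Rightarrow> ('d \<Rightarrow>\<^sub>0 'k)" and g :: "('c \<Rightarrow>\<^sub>0 'k) \<Rightarrow> ('e \<Rightarrow>\<^sub>0 'k)"
  assumes f: "linear_on (free_space B) scale f" and g: "linear_on (free_space C) scale g"
    and a: "a \<in> free_space B" and b: "b \<in> free_space C"
  shows "tensor_map f g (tensor a b) = tensor (f a) (g b)"
proof -
  have l: "linear_on (free_space B) scale (\<lambda>a. tensor (f a) q)" for q :: "'e \<Rightarrow>\<^sub>0 'k"
    using f by (simp add: linear_on_def tensor_add_left tensor_scale_left)
  have r: "linear_on (free_space C) scale (\<lambda>b. tensor p (g b))" for p :: "'d \<Rightarrow>\<^sub>0 'k"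
    using g by (simp add: linear_on_def tensor_add_right tensor_scale_right)
  have "tensor (f a) (g b) = (\<Sum>x\<in>Poly_Mapping.keys a. scale (Poly_Mapping.lookup a x) (\<Sum>y\<in>Poly_Mapping.keys b.
      scale (Poly_Mapping.lookup b y) (tensor (f (basis_vector x)) (g (basis_vector y)))))"
    unfolding linear_on_extension[OF l scale.vector_space_axioms a, unfolded linear_extension_def]
    by (subst linear_on_extension[OF r scale.vector_space_axioms b, unfolded linear_extension_def]) simp
  also have "\<dots> = tensor_map f g (tensor a b)"
    by (simp add: tensor_map_def linear_extension_def keys_tensor lookup_tensor'
        scale.scale_sum_right sum.cartesian_product case_prod_unfold)
  finally show ?thesis by simp
qed

lemma poly_mapping_add_induct:
  fixes p :: "'b \<Rightarrow>\<^sub>0 'k::field"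
  assumes "\<And>x c. P (Poly_Mapping.single x c)" "\<And>p q. P p \<Longrightarrow> P q \<Longrightarrow> P (p + q)"
  shows "P p"
proof -
  have "P 0" using assms(1)[of _ 0] by simp
  then have "P (\<Sum>x\<in>Poly_Mapping.keys p. scale (Poly_Mapping.lookup p x) (basis_vector x))"
    by (induction rule: infinite_finite_induct) (auto simp: assms)
  then show ?thesis by (simp only: sum_basis)
qed

lemma tensor_one: "tensor 1 1 = 1"
  by (metis mult_1 single_one tensor_single zero_prod_def)

lemma tensor_mult:
  fixes a c :: "'b::comm_monoid_add \<Rightarrow>\<^sub>0 'k::field" and b d :: "'c::comm_monoid_add \<Rightarrow>\<^sub>0 'k"
  shows "tensor a b * tensor c d = tensor (a * c) (b * d)"
proof (induction a rule: poly_mapping_add_induct)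
  case (1 x r)
  show ?case
  proof (induction b rule: poly_mapping_add_induct)
    case (1 y s)
    show ?case
    proof (induction c rule: poly_mapping_add_induct)
      case (1 z t)
      show ?case
      proof (induction d rule: poly_mapping_add_induct)
        case (1 w v)
        show ?case by (simp add: mult_single plus_prod_def mult.assoc mult.left_commute)
      qed (simp add: tensor_add_right distrib_left)
    qed (simp add: tensor_add_left distrib_left)
  qed (simp add: tensor_add_right distrib_right)
qed (simp add: tensor_add_left distrib_right)

lemma scale_mult:
  fixes p q :: "'b::comm_monoid_add \<Rightarrow>\<^sub>0 'k::field"
  shows "scale c p * q = scale c (p * q)" "p * scale c q = scale c (p * q)"
proof -
  have s: "scale c p = Poly_Mapping.single 0 c * p" for p :: "'b \<Rightarrow>\<^sub>0 'k"
    unfolding scale_def by (rule mult_map_scale_conv_mult)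
  show "scale c p * q = scale c (p * q)" "p * scale c q = scale c (p * q)"
    by (simp_all add: s mult_ac)
qed

section \<open>The coproduct\<close>

definition graph_coproduct ::
  "'t set \<Rightarrow> ('t \<Rightarrow> nat) set \<Rightarrow> ('v, 'h, 't) fgraph \<Rightarrow> ('t igraph \<times> 't igraph \<Rightarrow>\<^sub>0 complex)" where
  "graph_coproduct E V G =
     (\<Sum>\<gamma> | \<gamma> \<in> covering_subgraphs G \<and> locally_1PI \<gamma> \<and> in_theory E V (contract G \<gamma>).
        tensor (basis_vector (iso_class \<gamma>)) (basis_vector (iso_class (contract G \<gamma>))))"

lemma graph_coproduct_isomorphic:
  assumes G: "feynman_graph G" and "G \<simeq> H"
  shows "graph_coproduct E V G = graph_coproduct E V H"
proof -
  obtain f g where iso: "is_iso f g G H" using assms(2) unfolding isomorphic_def by blast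
  have H: "feynman_graph H" by (rule iso_feynman_graph[OF G iso])
  note iso' = iso_sym[OF G iso]
  have fwd: "transport_subgraph g G H \<gamma> \<in> covering_subgraphs H"
      "locally_1PI \<gamma> \<Longrightarrow> locally_1PI (transport_subgraph g G H \<gamma>)"
      "in_theory E V (contract G \<gamma>) \<Longrightarrow> in_theory E V (contract H (transport_subgraph g G H \<gamma>))"
      "iso_class (transport_subgraph g G H \<gamma>) = iso_class \<gamma>"
      "iso_class (contract H (transport_subgraph g G H \<gamma>)) = iso_class (contract G \<gamma>)"
    if \<gamma>: "\<gamma> \<in> covering_subgraphs G"
      and iso: "is_iso f g G H" and G: "feynman_graph G" and H: "feynman_graph H"
    for f :: "'x \<Rightarrow> 'y" and g :: "'p \<Rightarrow> 'q" and G :: "('x, 'p, 't) fgraph" and H \<gamma> and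
      E :: "'t set" and V
  proof -
    note t = transport_subgraph[OF iso G \<gamma>]
    note F = feynman_graph_covering[OF G \<gamma>] feynman_graph_contract[OF G \<gamma>]
    note F' = feynman_graph_covering[OF H t(1)] feynman_graph_contract[OF H t(1)]
    show "transport_subgraph g G H \<gamma> \<in> covering_subgraphs H" by (rule t(1))
    show "locally_1PI \<gamma> \<Longrightarrow> locally_1PI (transport_subgraph g G H \<gamma>)"
      by (rule iso_locally_1PI[OF t(2) F(1)])
    show "in_theory E V (contract G \<gamma>) \<Longrightarrow> in_theory E V (contract H (transport_subgraph g G H \<gamma>))"
      by (rule iso_in_theory[OF t(3) F(2)])
    have "iso_class \<gamma> = iso_class (transport_subgraph g G H \<gamma>)"
      unfolding iso_class_eq_iff[OF F(1) F'(1)] isomorphic_def using t(2) by blast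
    then show "iso_class (transport_subgraph g G H \<gamma>) = iso_class \<gamma>" ..
    have "iso_class (contract G \<gamma>) = iso_class (contract H (transport_subgraph g G H \<gamma>))"
      unfolding iso_class_eq_iff[OF F(2) F'(2)] isomorphic_def using t(3) by blast
    then show "iso_class (contract H (transport_subgraph g G H \<gamma>)) = iso_class (contract G \<gamma>)" ..
  qed
  show ?thesis unfolding graph_coproduct_def
    by (rule sum.reindex_bij_witness[where
          i = "transport_subgraph (inv_into (hedges G) g) H G" and j = "transport_subgraph g G H"])
      (auto simp: transport_subgraph_inverse[OF iso G] fwd[OF _ iso G H] fwd[OF _ iso' H G])
qed

lift_definition class_coproduct ::
  "'t set \<Rightarrow> ('t \<Rightarrow> nat) set \<Rightarrow> 't igraph \<Rightarrow> ('t igraph \<times> 't igraph \<Rightarrow>\<^sub>0 complex)"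
  is graph_coproduct
  using graph_coproduct_isomorphic by blast

definition coproduct ::
  "'t set \<Rightarrow> ('t \<Rightarrow> nat) set \<Rightarrow> ('t igraph \<Rightarrow>\<^sub>0 complex) \<Rightarrow> ('t igraph \<times> 't igraph \<Rightarrow>\<^sub>0 complex)" where
  "coproduct E V = linear_extension scale (class_coproduct E V)"

lemma coproduct_graph:
  assumes "feynman_graph G"
  shows "coproduct E V (basis_vector (iso_class G)) = graph_coproduct E V G"
proof -
  have "coproduct E V (basis_vector (iso_class G)) = class_coproduct E V (iso_class G)"
    unfolding coproduct_def by (rule linear_extension_basis[OF scale.vector_space_axioms])
  also have "\<dots> = graph_coproduct E V (nat_copy G)"
    unfolding iso_class_def using nat_copy[OF assms] by (simp add: class_coproduct.abs_eq)
  also have "\<dots> = graph_coproduct E V G"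
    using graph_coproduct_isomorphic[OF assms nat_copy(2)[OF assms]] by simp
  finally show ?thesis .
qed

end

theory Submission
  imports Defs
begin

text \<open>
  Being locally 1PI means that the end points of every internal edge remain connected when that
  edge is cut. In this form it is clear that for \<open>\<delta> \<subseteq> \<gamma>\<close> with \<open>\<delta>\<close> locally 1PI, the graph \<open>\<gamma>\<close> is
  locally 1PI iff \<open>\<gamma>/\<delta>\<close> is: edges of \<open>\<delta>\<close> can be bypassed inside \<open>\<delta>\<close>, and reachability in \<open>\<gamma>\<close> is
  reachability in \<open>\<gamma>/\<delta>\<close> because the components of \<open>\<delta>\<close> are connected. Superficial divergence of
  \<open>\<Gamma>\<close> says that \<open>\<Gamma>/\<Gamma>\<close> is in the theory, so it passes to \<open>\<Gamma>/\<delta>\<close> by \<open>(\<Gamma>/\<delta>)/(\<Gamma>/\<delta>) \<cong> \<Gamma>/\<Gamma>\<close>.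
  Coassociativity is the bijection \<open>\<gamma> \<mapsto> \<gamma>/\<delta>\<close> from the subgraphs of \<open>\<Gamma>\<close> containing \<open>\<delta>\<close> to the
  subgraphs of \<open>\<Gamma>/\<delta>\<close>, together with \<open>(\<Gamma>/\<delta>)/(\<gamma>/\<delta>) \<cong> \<Gamma>/\<gamma>\<close>. The counit is the indicator of the
  graphs without internal edges.
\<close>

section \<open>Reachability\<close>

lemma adjacentI:
  "e \<in> hedges G \<Longrightarrow> invol G e \<noteq> e \<Longrightarrow> (att G e, att G (invol G e)) \<in> adjacent G"
  by (auto simp: adjacent_def)

lemma sym_adjacent:
  assumes "feynman_graph G"
  shows "sym ((adjacent G)\<^sup>*)"
proof (rule sym_rtrancl, rule symI)
  fix v w assume "(v, w) \<in> adjacent G"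
  then obtain e where "e \<in> hedges G" "invol G e \<noteq> e" "v = att G e" "w = att G (invol G e)"
    by (auto simp: adjacent_def)
  then show "(w, v) \<in> adjacent G"
    using adjacentI[of "invol G e" G] feynman_graphD(3,4)[OF assms] by metis
qed

lemma rtrancl_adjacent_verts:
  assumes "feynman_graph G" "(v, w) \<in> (adjacent G)\<^sup>*" "v \<in> verts G"
  shows "w \<in> verts G"
  using assms(2,3) feynman_graphD(3,5)[OF assms(1)]
  by induction (auto simp: adjacent_def)

lemma conn_class:
  assumes "feynman_graph G" "v \<in> verts G"
  shows "conn_rel G `` {v} = {w. (v, w) \<in> (adjacent G)\<^sup>*}"
  using assms rtrancl_adjacent_verts[OF assms(1)] by (auto simp: conn_rel_def)

lemma conn_class_eq_iff:
  assumes "feynman_graph G" "v \<in> verts G" "w \<in> verts G"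
  shows "conn_rel G `` {v} = conn_rel G `` {w} \<longleftrightarrow> (v, w) \<in> (adjacent G)\<^sup>*"
  unfolding conn_class[OF assms(1,2)] conn_class[OF assms(1,3)]
  using symD[OF sym_adjacent[OF assms(1)]] by (auto intro: rtrancl_trans)

lemma component_eq_class:
  assumes "feynman_graph G" "C \<in> components G" "v \<in> C"
  shows "C = conn_rel G `` {v}"
proof -
  obtain u where u: "u \<in> verts G" "C = conn_rel G `` {u}"
    using assms(2) by (auto simp: components_image)
  then have "(u, v) \<in> (adjacent G)\<^sup>*" "v \<in> verts G"
    using assms(3) by (auto simp: conn_rel_def)
  then show ?thesis using conn_class_eq_iff[OF assms(1)] u by simp
qed

lemma component_nonempty: "C \<in> components G \<Longrightarrow> C \<noteq> {}"
  using conn_rel_refl[of _ G] by (auto simp: components_image)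

lemma connected_graph_iff:
  assumes "feynman_graph G"
  shows "connected_graph G \<longleftrightarrow> verts G \<noteq> {} \<and> verts G \<times> verts G \<subseteq> (adjacent G)\<^sup>*"
proof
  assume "connected_graph G"
  then obtain C where C: "components G = {C}"
    unfolding connected_graph_def by (rule card_1_singletonE)
  then have "\<forall>v\<in>verts G. conn_rel G `` {v} = C" by (auto simp: components_image)
  then have "(v, w) \<in> (adjacent G)\<^sup>*" if "v \<in> verts G" "w \<in> verts G" for v w
    using conn_class_eq_iff[OF assms that] that by simp
  moreover have "verts G \<noteq> {}" using C by (auto simp: components_image)
  ultimately show "verts G \<noteq> {} \<and> verts G \<times> verts G \<subseteq> (adjacent G)\<^sup>*" by auto
next
  assume R: "verts G \<noteq> {} \<and> verts G \<times> verts G \<subseteq> (adjacent G)\<^sup>*"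
  then obtain v where v: "v \<in> verts G" by blast
  have "conn_rel G `` {w} = conn_rel G `` {v}" if "w \<in> verts G" for w
    unfolding conn_class_eq_iff[OF assms that v] using R that v by blast
  then have "components G = {conn_rel G `` {v}}"
    unfolding components_image using v by (blast intro: image_eqI)
  then show "connected_graph G" by (simp add: connected_graph_def)
qed

lemma rtrancl_adjacent_restrict:
  assumes "\<And>e. e \<in> hedges G \<Longrightarrow> att G e \<in> C \<Longrightarrow> att G (invol G e) \<in> C" "v \<in> C"
  shows "(v, w) \<in> (adjacent (restrict_verts G C))\<^sup>* \<longleftrightarrow> (v, w) \<in> (adjacent G)\<^sup>*"
proof
  assume "(v, w) \<in> (adjacent (restrict_verts G C))\<^sup>*"
  moreover have "adjacent (restrict_verts G C) \<subseteq> adjacent G"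
    by (auto simp: adjacent_def restrict_verts_def)
  ultimately show "(v, w) \<in> (adjacent G)\<^sup>*" using rtrancl_mono by blast
next
  assume "(v, w) \<in> (adjacent G)\<^sup>*"
  then have "(v, w) \<in> (adjacent (restrict_verts G C))\<^sup>* \<and> w \<in> C"
  proof induction
    case (step x y)
    then have "(x, y) \<in> adjacent (restrict_verts G C)" "y \<in> C"
      using assms(1) by (auto simp: adjacent_def restrict_verts_def)
    then show ?case using step.IH by (auto intro: rtrancl_into_rtrancl)
  qed (use assms(2) in simp)
  then show "(v, w) \<in> (adjacent (restrict_verts G C))\<^sup>*" ..
qed

lemma cut_restrict_verts: "cut e (restrict_verts G C) = restrict_verts (cut e G) C"
  by (simp add: cut_def restrict_verts_def)

lemma cut_simps [simp]:
  "verts (cut e G) = verts G" "hedges (cut e G) = hedges G" "att (cut e G) = att G"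
  "htype (cut e G) = htype G"
  by (simp_all add: cut_def)

lemma adjacent_cut_subset:
  assumes "feynman_graph G" "e \<in> hedges G"
    and "(att G e, att G (invol G e)) \<in> (adjacent (cut e G))\<^sup>*"
  shows "adjacent G \<subseteq> (adjacent (cut e G))\<^sup>*"
proof (rule subrelI)
  fix v w assume "(v, w) \<in> adjacent G"
  then obtain d where d: "d \<in> hedges G" "invol G d \<noteq> d" "v = att G d" "w = att G (invol G d)"
    by (auto simp: adjacent_def)
  consider "d = e" | "d = invol G e" | "d \<noteq> e" "d \<noteq> invol G e" by blast
  then show "(v, w) \<in> (adjacent (cut e G))\<^sup>*"
  proof cases
    case 1
    then show ?thesis using d assms(3) by simp
  next
    case 2
    then show ?thesis
      using d symD[OF sym_adjacent[OF feynman_graph_cut[OF assms(1,2)]] assms(3)]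
        feynman_graphD(4)[OF assms(1,2)] by simp
  next
    case 3
    then have "invol (cut e G) d = invol G d" by (simp add: cut_def)
    then show ?thesis using adjacentI[of d "cut e G"] d by auto
  qed
qed

lemma locally_1PI_iff:
  assumes G: "feynman_graph G"
  shows "locally_1PI G \<longleftrightarrow> (\<forall>e\<in>hedges G. invol G e \<noteq> e \<longrightarrow>
    (att G e, att G (invol G e)) \<in> (adjacent (cut e G))\<^sup>*)"
proof -
  note F = feynman_graphD[OF G]
  have closed: "att G (invol (cut e G) d) \<in> C"
    if "C \<in> components G" "d \<in> hedges G" "att G d \<in> C" for C d e
    using component_invol[OF G that] that(3) by (auto simp: cut_def)
  have cut_connected: "connected_graph (cut e (restrict_verts G C)) \<longleftrightarrow>
      C \<times> C \<subseteq> (adjacent (cut e G))\<^sup>*"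
    if C: "C \<in> components G" and e: "e \<in> hedges G" "att G e \<in> C" for C e
  proof -
    have f: "feynman_graph (cut e (restrict_verts G C))"
      by (rule feynman_graph_cut[OF feynman_graph_component[OF G C]])
        (use e in \<open>simp add: restrict_verts_def\<close>)
    have "(v, w) \<in> (adjacent (restrict_verts (cut e G) C))\<^sup>* \<longleftrightarrow> (v, w) \<in> (adjacent (cut e G))\<^sup>*"
      if "v \<in> C" for v w
      by (rule rtrancl_adjacent_restrict) (use that closed[OF C] in auto)
    moreover have "verts (restrict_verts (cut e G) C) = C" by (simp add: restrict_verts_def)
    ultimately show ?thesis
      unfolding connected_graph_iff[OF f, unfolded cut_restrict_verts] cut_restrict_verts using component_nonempty[OF C] by auto
  qed
  have connected: "connected_graph (restrict_verts G C)" if C: "C \<in> components G" for C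
  proof -
    have "(v, w) \<in> (adjacent (restrict_verts G C))\<^sup>*" if "v \<in> C" "w \<in> C" for v w
    proof -
      have "(v, w) \<in> (adjacent G)\<^sup>*"
        using component_eq_class[OF G C that(1)] that(2) by (auto simp: conn_rel_def)
      then show ?thesis
        using rtrancl_adjacent_restrict[of G C v w] component_invol[OF G C] that by blast
    qed
    then show ?thesis
      unfolding connected_graph_iff[OF feynman_graph_component[OF G C]]
      using component_nonempty[OF C] by (auto simp: restrict_verts_def)
  qed
  show ?thesis
  proof
    assume L: "locally_1PI G"
    show "\<forall>e\<in>hedges G. invol G e \<noteq> e \<longrightarrow>
      (att G e, att G (invol G e)) \<in> (adjacent (cut e G))\<^sup>*"
    proof (intro ballI impI)
      fix e assume e: "e \<in> hedges G" "invol G e \<noteq> e"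
      define C where "C = conn_rel G `` {att G e}"
      have C: "C \<in> components G" "att G e \<in> C"
        using F(5)[OF e(1)] conn_rel_refl by (auto simp: C_def components_image)
      then have "connected_graph (cut e (restrict_verts G C))"
        using L e unfolding locally_1PI_def one_PI_def by (auto simp: restrict_verts_def)
      then show "(att G e, att G (invol G e)) \<in> (adjacent (cut e G))\<^sup>*"
        using cut_connected[OF C(1) e(1) C(2)] component_invol[OF G C(1) e(1) C(2)] C(2) by auto
    qed
  next
    assume R: "\<forall>e\<in>hedges G. invol G e \<noteq> e \<longrightarrow>
      (att G e, att G (invol G e)) \<in> (adjacent (cut e G))\<^sup>*"
    have "connected_graph (cut e (restrict_verts G C))"
      if C: "C \<in> components G" and e: "e \<in> hedges G" "att G e \<in> C" "invol G e \<noteq> e" for C e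
    proof -
      have "(adjacent G)\<^sup>* \<subseteq> (adjacent (cut e G))\<^sup>*"
        by (rule rtrancl_subset_rtrancl[OF adjacent_cut_subset[OF G e(1)]]) (use R e in blast)
      moreover have "C \<times> C \<subseteq> (adjacent G)\<^sup>*"
        using component_eq_class[OF G C] by (fastforce simp: conn_rel_def)
      ultimately show ?thesis using cut_connected[OF C e(1,2)] by blast
    qed
    then show "locally_1PI G"
      unfolding locally_1PI_def one_PI_def using connected by (auto simp: restrict_verts_def)
  qed
qed

lemma superficially_divergent_iff:
  assumes G: "feynman_graph G"
  shows "superficially_divergent V G \<longleftrightarrow> (\<forall>C\<in>components G. vertex_type (contract G G) C \<in> V)"
proof -
  have "residue_in_theory V (restrict_verts G C) \<longleftrightarrow> vertex_type (contract G G) C \<in> V"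
    if C: "C \<in> components G" for C
  proof -
    let ?R = "restrict_verts G C"
    have conn: "conn_rel ?R `` {v} = C" if "v \<in> C" for v
    proof -
      have "(v, w) \<in> (adjacent ?R)\<^sup>* \<longleftrightarrow> (v, w) \<in> (adjacent G)\<^sup>*" for w
        by (rule rtrancl_adjacent_restrict) (use that component_invol[OF G C] in auto)
      then have "conn_rel ?R `` {v} = C \<inter> conn_rel G `` {v}"
        using that component_subset[OF C] by (auto simp: conn_rel_def restrict_verts_def)
      then show ?thesis using component_eq_class[OF G C that] by simp
    qed
    have "components ?R = (\<lambda>v. conn_rel ?R `` {v}) ` C"
      by (simp add: components_image restrict_verts_def)
    also have "\<dots> = {C}" using conn component_nonempty[OF C] by auto
    finally have comp: "verts (residue ?R) = {C}"
      by (simp add: residue_def contract_def)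
    have "conn_rel G `` {v} = C \<longleftrightarrow> v \<in> C" if "v \<in> verts G" for v
      using component_eq_class[OF G C] conn_rel_refl[OF that] by auto
    then have "{e \<in> star (residue ?R) C. htype (residue ?R) e = t} =
        {e \<in> star (contract G G) C. htype (contract G G) e = t}" for t
      using conn feynman_graphD(5)[OF G]
      by (auto simp: star_def residue_def contract_def restrict_verts_def)
    then have "vertex_type (residue ?R) C = vertex_type (contract G G) C"
      by (simp add: vertex_type_def)
    then show ?thesis by (simp add: residue_in_theory_def comp)
  qed
  then show ?thesis by (simp add: superficially_divergent_def)
qed

lemma contract_simps [simp]:
  "verts (contract G g) = components g" "hedges (contract G g) = {e \<in> hedges G. invol g e = e}"
  "invol (contract G g) = invol G" "att (contract G g) = (\<lambda>e. conn_rel g `` {att G e})"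
  "htype (contract G g) = htype G"
  by (simp_all add: contract_def)

lemma superficially_divergent_iff_in_theory:
  assumes "feynman_graph G" "in_theory E V G"
  shows "superficially_divergent V G \<longleftrightarrow> in_theory E V (contract G G)"
  using assms(2) by (simp add: superficially_divergent_iff[OF assms(1)] in_theory_def)

section \<open>Nested contractions\<close>

lemma covering_subgraphI:
  fixes \<gamma> G :: "('v, 'h, 't) fgraph"
  assumes "verts \<gamma> = verts G" "hedges \<gamma> = hedges G" "att \<gamma> = att G" "htype \<gamma> = htype G"
    and "\<And>e. e \<notin> hedges G \<Longrightarrow> invol \<gamma> e = invol G e"
    and "\<And>e. e \<in> hedges G \<Longrightarrow> invol \<gamma> e \<in> {e, invol G e}"
    and "\<And>e. e \<in> hedges G \<Longrightarrow> invol \<gamma> e = e \<Longrightarrow> invol \<gamma> (invol G e) = invol G e"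
  shows "\<gamma> \<in> covering_subgraphs G"
  unfolding covering_subgraphs_def
proof (rule CollectI, rule exI, intro conjI allI ballI impI)
  show "\<gamma> = G\<lparr>invol := invol \<gamma>\<rparr>"
    using assms(1-4) by (intro fgraph.equality) simp_all
qed (rule assms(5-7); assumption)+

lemma covering_subgraph_self: "feynman_graph G \<Longrightarrow> G \<in> covering_subgraphs G"
  by (rule covering_subgraphI) (simp_all add: feynman_graphD(4))

lemma covering_subgraph_trans:
  assumes "\<delta> \<in> covering_subgraphs \<gamma>" "\<gamma> \<in> covering_subgraphs G"
  shows "\<delta> \<in> covering_subgraphs G"
proof (rule covering_subgraphI)
  note D = covering_subgraphD[OF assms(1)] and C = covering_subgraphD[OF assms(2)]
  show "verts \<delta> = verts G" "hedges \<delta> = hedges G" "att \<delta> = att G" "htype \<delta> = htype G"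
    using C D by simp_all
  show "e \<notin> hedges G \<Longrightarrow> invol \<delta> e = invol G e" for e using C(2,5) D(5) by simp
  show "e \<in> hedges G \<Longrightarrow> invol \<delta> e \<in> {e, invol G e}" for e using C(2,6) D(6) by force
  show "invol \<delta> (invol G e) = invol G e" if "e \<in> hedges G" "invol \<delta> e = e" for e
  proof (cases "invol \<gamma> e = e")
    case True
    then have "invol \<gamma> (invol G e) = invol G e" using C(7) that(1) by blast
    then show ?thesis using D(5,6)[of "invol G e"] by metis
  next
    case False
    then have "invol \<gamma> e = invol G e" using C(6)[OF that(1)] by blast
    then show ?thesis using D(7)[of e] C(2) that by simp
  qed
qed

lemma adjacent_covering_subset:
  assumes "\<delta> \<in> covering_subgraphs G"
  shows "adjacent \<delta> \<subseteq> adjacent G"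
proof (rule subrelI)
  note C = covering_subgraphD[OF assms]
  fix v w assume "(v, w) \<in> adjacent \<delta>"
  then obtain e where "e \<in> hedges \<delta>" "invol \<delta> e \<noteq> e" "v = att \<delta> e" "w = att \<delta> (invol \<delta> e)"
    by (auto simp: adjacent_def)
  then show "(v, w) \<in> adjacent G" using C(2,3) C(6)[of e] adjacentI[of e G] by auto
qed

lemma invol_cut: "invol (cut e G) d = (if d = e \<or> d = invol G e then d else invol G d)"
  by (simp add: cut_def)

lemma cut_covering_subgraph:
  assumes G: "feynman_graph G" and \<delta>: "\<delta> \<in> covering_subgraphs G" and e: "e \<in> hedges G"
  shows "invol \<delta> e \<noteq> e \<Longrightarrow> cut e \<delta> \<in> covering_subgraphs (cut e G)"
    and "invol \<delta> e = e \<Longrightarrow> \<delta> \<in> covering_subgraphs (cut e G)"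
proof -
  note F = feynman_graphD[OF G] and C = covering_subgraphD[OF \<delta>]
  have off: "d \<noteq> e" "d \<noteq> invol G e" if "d \<notin> hedges G" for d
    using that e F(3)[OF e] by blast+
  show "cut e \<delta> \<in> covering_subgraphs (cut e G)" if "invol \<delta> e \<noteq> e"
  proof (rule covering_subgraphI)
    have same: "invol \<delta> e = invol G e" using C(6)[OF e] that by simp
    show "invol (cut e \<delta>) d = invol (cut e G) d" if "d \<notin> hedges (cut e G)" for d
      using that off[of d] C(5)[of d] by (simp add: invol_cut same)
    show "invol (cut e \<delta>) d \<in> {d, invol (cut e G) d}" if "d \<in> hedges (cut e G)" for d
      using that C(6)[of d] by (simp add: invol_cut same)
    show "invol (cut e \<delta>) (invol (cut e G) d) = invol (cut e G) d"
      if "d \<in> hedges (cut e G)" "invol (cut e \<delta>) d = d" for d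
      using that C(7)[of d] by (auto simp only: invol_cut same cut_simps split: if_splits)
  qed (simp_all add: C(1-4))
  show "\<delta> \<in> covering_subgraphs (cut e G)" if fix_e: "invol \<delta> e = e"
  proof (rule covering_subgraphI)
    have fix_e': "invol \<delta> (invol G e) = invol G e" using C(7)[OF e fix_e] .
    show "invol \<delta> d = invol (cut e G) d" if "d \<notin> hedges (cut e G)" for d
      using that off[of d] C(5)[of d] by (simp add: invol_cut)
    show "invol \<delta> d \<in> {d, invol (cut e G) d}" if "d \<in> hedges (cut e G)" for d
      using that C(6)[of d] fix_e fix_e' by (auto simp only: invol_cut cut_simps split: if_splits)
    show "invol \<delta> (invol (cut e G) d) = invol (cut e G) d"
      if "d \<in> hedges (cut e G)" "invol \<delta> d = d" for d
      using that C(7)[of d] by (auto simp only: invol_cut cut_simps split: if_splits)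
  qed (simp_all add: C(1-4))
qed

lemma cut_contract: "cut e (contract G \<delta>) = contract (cut e G) \<delta>"
  by (simp add: cut_def contract_def)

lemma reachable_contract_iff:
  assumes G: "feynman_graph G" and \<delta>: "\<delta> \<in> covering_subgraphs G"
    and v: "v \<in> verts G" and w: "w \<in> verts G"
  shows "(conn_rel \<delta> `` {v}, conn_rel \<delta> `` {w}) \<in> (adjacent (contract G \<delta>))\<^sup>* \<longleftrightarrow>
    (v, w) \<in> (adjacent G)\<^sup>*"
proof
  note F = feynman_graphD[OF G] and C = covering_subgraphD[OF \<delta>]
  note f\<delta> = feynman_graph_covering[OF G \<delta>]
  have sub: "(adjacent \<delta>)\<^sup>* \<subseteq> (adjacent G)\<^sup>*"
    by (rule rtrancl_mono[OF adjacent_covering_subset[OF \<delta>]])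
  let ?\<pi> = "\<lambda>v. conn_rel \<delta> `` {v}"
  {
    assume "(?\<pi> v, ?\<pi> w) \<in> (adjacent (contract G \<delta>))\<^sup>*"
    then have "\<forall>u\<in>?\<pi> w. (v, u) \<in> (adjacent G)\<^sup>*"
    proof induction
      case base
      then show ?case using sub by (auto simp: conn_rel_def)
    next
      case (step X Y)
      then obtain e where e: "e \<in> hedges G" "X = ?\<pi> (att G e)" "Y = ?\<pi> (att G (invol G e))"
          "invol G e \<noteq> e"
        by (auto simp: adjacent_def)
      have "(v, att G e) \<in> (adjacent G)\<^sup>*"
        using step.IH e C(1) F(5)[OF e(1)] conn_rel_refl[of "att G e" \<delta>] by simp
      then have "(v, att G (invol G e)) \<in> (adjacent G)\<^sup>*"
        using adjacentI[OF e(1,4)] by (rule rtrancl_into_rtrancl)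
      then show ?case using e(3) sub by (auto simp: conn_rel_def)
    qed
    then show "(v, w) \<in> (adjacent G)\<^sup>*" using conn_rel_refl[of w \<delta>] w C(1) by auto
  next
    assume "(v, w) \<in> (adjacent G)\<^sup>*"
    then show "(?\<pi> v, ?\<pi> w) \<in> (adjacent (contract G \<delta>))\<^sup>*"
    proof induction
      case (step x y)
      then obtain e where e: "e \<in> hedges G" "x = att G e" "y = att G (invol G e)" "invol G e \<noteq> e"
        by (auto simp: adjacent_def)
      show ?case
      proof (cases "invol \<delta> e = e")
        case True
        then have "(?\<pi> x, ?\<pi> y) \<in> adjacent (contract G \<delta>)"
          using e adjacentI[of e "contract G \<delta>"] by simp
        then show ?thesis using step.IH by (auto intro: rtrancl_into_rtrancl)
      next
        case False
        then have "(x, y) \<in> adjacent \<delta>"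
          using e C(2,3) C(6)[OF e(1)] adjacentI[of e \<delta>] by auto
        then have "?\<pi> x = ?\<pi> y"
          using conn_class_eq_iff[OF f\<delta>] e(2,3) F(3,5)[OF e(1)] F(5)[OF F(3)[OF e(1)]] C(1) by auto
        then show ?thesis using step.IH by simp
      qed
    qed simp
  }
qed

lemma locally_1PI_contract_iff:
  assumes G: "feynman_graph G" and \<delta>: "\<delta> \<in> covering_subgraphs G"
  shows "locally_1PI (contract G \<delta>) \<longleftrightarrow> (\<forall>e\<in>hedges G. invol \<delta> e = e \<longrightarrow> invol G e \<noteq> e \<longrightarrow>
    (att G e, att G (invol G e)) \<in> (adjacent (cut e G))\<^sup>*)"
proof -
  note F = feynman_graphD[OF G]
  have "(conn_rel \<delta> `` {att G e}, conn_rel \<delta> `` {att G (invol G e)})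
        \<in> (adjacent (contract (cut e G) \<delta>))\<^sup>* \<longleftrightarrow>
      (att G e, att G (invol G e)) \<in> (adjacent (cut e G))\<^sup>*"
    if e: "e \<in> hedges G" "invol \<delta> e = e" for e
    using reachable_contract_iff[OF feynman_graph_cut[OF G e(1)] cut_covering_subgraph(2)[OF G \<delta> e]]
      F(5)[OF e(1)] F(5)[OF F(3)[OF e(1)]] by simp
  then show ?thesis
    unfolding locally_1PI_iff[OF feynman_graph_contract[OF G \<delta>]] cut_contract by auto
qed

lemma locally_1PI_contract:
  assumes "feynman_graph G" "\<delta> \<in> covering_subgraphs G" "locally_1PI G"
  shows "locally_1PI (contract G \<delta>)"
  using assms(3) unfolding locally_1PI_contract_iff[OF assms(1,2)] locally_1PI_iff[OF assms(1)]
  by blast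

lemma locally_1PI_of_contract:
  assumes G: "feynman_graph G" and \<delta>: "\<delta> \<in> covering_subgraphs G"
    and "locally_1PI \<delta>" "locally_1PI (contract G \<delta>)"
  shows "locally_1PI G"
  unfolding locally_1PI_iff[OF G]
proof (intro ballI impI)
  note C = covering_subgraphD[OF \<delta>]
  fix e assume e: "e \<in> hedges G" "invol G e \<noteq> e"
  show "(att G e, att G (invol G e)) \<in> (adjacent (cut e G))\<^sup>*"
  proof (cases "invol \<delta> e = e")
    case True
    then show ?thesis using assms(4) e unfolding locally_1PI_contract_iff[OF G \<delta>] by blast
  next
    case False
    then have "(att G e, att G (invol G e)) \<in> (adjacent (cut e \<delta>))\<^sup>*"
      using assms(3) e C(2,3) C(6)[OF e(1)]
      unfolding locally_1PI_iff[OF feynman_graph_covering[OF G \<delta>]] by force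
    then show ?thesis
      using rtrancl_mono[OF adjacent_covering_subset[OF cut_covering_subgraph(1)[OF G \<delta> e(1) False]]]
      by blast
  qed
qed

text \<open>
  The subgraph \<open>\<gamma>/\<delta>\<close> of \<open>G/\<delta>\<close>; unlike \<open>contract \<gamma> \<delta>\<close> it agrees with \<open>G/\<delta>\<close> outside the graph.
\<close>

definition contract_subgraph ::
  "('v, 'h, 't) fgraph \<Rightarrow> ('v, 'h, 't) fgraph \<Rightarrow> ('v, 'h, 't) fgraph \<Rightarrow> ('v set, 'h, 't) fgraph" where
  "contract_subgraph G \<delta> \<gamma> = (contract G \<delta>)\<lparr>invol := (\<lambda>e. if e \<in> hedges G \<and> invol \<delta> e = e
     then invol \<gamma> e else invol G e)\<rparr>"

definition expand_subgraph ::
  "('v, 'h, 't) fgraph \<Rightarrow> ('v, 'h, 't) fgraph \<Rightarrow> ('v set, 'h, 't) fgraph \<Rightarrow> ('v, 'h, 't) fgraph" where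
  "expand_subgraph G \<delta> \<gamma>' = G\<lparr>invol := (\<lambda>e. if e \<in> hedges G \<and> invol \<delta> e = e
     then invol \<gamma>' e else invol G e)\<rparr>"

lemma contract_subgraph_covering:
  assumes G: "feynman_graph G" and \<gamma>: "\<gamma> \<in> covering_subgraphs G" and \<delta>: "\<delta> \<in> covering_subgraphs \<gamma>"
  shows "contract_subgraph G \<delta> \<gamma> \<in> covering_subgraphs (contract G \<delta>)"
proof -
  note F = feynman_graphD[OF G] and C = covering_subgraphD[OF \<gamma>]
  note D = covering_subgraphD[OF covering_subgraph_trans[OF \<delta> \<gamma>]]
  show ?thesis
    by (rule covering_subgraphI) (use C F D(7) in \<open>auto simp: contract_subgraph_def\<close>)
qed

lemma expand_subgraph_covering:
  assumes G: "feynman_graph G" and \<delta>: "\<delta> \<in> covering_subgraphs G"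
    and \<gamma>: "\<gamma>' \<in> covering_subgraphs (contract G \<delta>)"
  shows "expand_subgraph G \<delta> \<gamma>' \<in> covering_subgraphs G"
    and "\<delta> \<in> covering_subgraphs (expand_subgraph G \<delta> \<gamma>')"
proof -
  note F = feynman_graphD[OF G] and D = covering_subgraphD[OF \<delta>]
  have C: "invol \<gamma>' e \<in> {e, invol G e}" "invol \<gamma>' e = e \<Longrightarrow> invol \<gamma>' (invol G e) = invol G e"
    if "e \<in> hedges G" "invol \<delta> e = e" for e
    using covering_subgraphD(6,7)[OF \<gamma>, of e] that by auto
  have fix_iff: "invol \<delta> (invol G e) = invol G e \<longleftrightarrow> invol \<delta> e = e" if "e \<in> hedges G" for e
    using D(7)[OF that] D(7)[OF F(3)[OF that]] F(4)[OF that] by metis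
  show "expand_subgraph G \<delta> \<gamma>' \<in> covering_subgraphs G"
    by (rule covering_subgraphI) (use C F fix_iff in \<open>auto simp: expand_subgraph_def\<close>)
  show "\<delta> \<in> covering_subgraphs (expand_subgraph G \<delta> \<gamma>')"
  proof (rule covering_subgraphI)
    show "invol \<delta> (invol (expand_subgraph G \<delta> \<gamma>') e) = invol (expand_subgraph G \<delta> \<gamma>') e"
      if "e \<in> hedges (expand_subgraph G \<delta> \<gamma>')" "invol \<delta> e = e" for e
      using C[of e] fix_iff[of e] that by (auto simp: expand_subgraph_def)
  qed (use D in \<open>auto simp: expand_subgraph_def\<close>)
qed

lemma expand_contract_subgraph:
  assumes "\<gamma> \<in> covering_subgraphs G" "\<delta> \<in> covering_subgraphs \<gamma>"
  shows "expand_subgraph G \<delta> (contract_subgraph G \<delta> \<gamma>) = \<gamma>"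
proof -
  note C = covering_subgraphD[OF assms(1)] and D = covering_subgraphD[OF assms(2)]
  have "invol (expand_subgraph G \<delta> (contract_subgraph G \<delta> \<gamma>)) e = invol \<gamma> e" for e
  proof (cases "e \<in> hedges G \<and> invol \<delta> e = e")
    case False
    then have "invol \<gamma> e = invol G e" using C(2) C(5,6)[of e] D(6)[of e] by metis
    then show ?thesis using False by (auto simp: expand_subgraph_def)
  qed (simp add: expand_subgraph_def contract_subgraph_def)
  then have "invol (expand_subgraph G \<delta> (contract_subgraph G \<delta> \<gamma>)) = invol \<gamma>" by blast
  then show ?thesis using C(8) unfolding expand_subgraph_def by simp
qed

lemma contract_expand_subgraph:
  assumes "\<gamma>' \<in> covering_subgraphs (contract G \<delta>)"
  shows "contract_subgraph G \<delta> (expand_subgraph G \<delta> \<gamma>') = \<gamma>'"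
proof -
  note C = covering_subgraphD[OF assms]
  have "invol (contract_subgraph G \<delta> (expand_subgraph G \<delta> \<gamma>')) e = invol \<gamma>' e" for e
    using C(5)[of e] by (auto simp: expand_subgraph_def contract_subgraph_def)
  then have "invol (contract_subgraph G \<delta> (expand_subgraph G \<delta> \<gamma>')) = invol \<gamma>'" by blast
  then show ?thesis using C(8) unfolding contract_subgraph_def by simp
qed

lemma iso_contract_subgraph:
  assumes "\<gamma> \<in> covering_subgraphs G"
  shows "is_iso id id (contract \<gamma> \<delta>) (contract_subgraph G \<delta> \<gamma>)"
  using covering_subgraphD[OF assms] by (simp add: is_iso_def contract_subgraph_def)

lemma iso_contract_contract:
  assumes G: "feynman_graph G" and \<gamma>: "\<gamma> \<in> covering_subgraphs G" and \<delta>: "\<delta> \<in> covering_subgraphs \<gamma>"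
  shows "is_iso Union id (contract (contract G \<delta>) (contract_subgraph G \<delta> \<gamma>)) (contract G \<gamma>)"
proof -
  note F = feynman_graphD[OF G] and C = covering_subgraphD[OF \<gamma>] and D = covering_subgraphD[OF \<delta>]
  note f\<gamma> = feynman_graph_covering[OF G \<gamma>] and f\<delta> = feynman_graph_covering[OF f\<gamma> \<delta>]
  let ?q = "contract_subgraph G \<delta> \<gamma>"
  let ?\<pi> = "\<lambda>v. conn_rel \<delta> `` {v}"
  let ?\<kappa> = "\<lambda>v. conn_rel ?q `` {?\<pi> v}"
  have verts: "verts ?q = ?\<pi> ` verts G"
    using C(1) D(1) by (simp add: contract_subgraph_def components_image)
  have adj: "adjacent ?q = adjacent (contract \<gamma> \<delta>)"
    using C(2,3) by (auto simp: adjacent_def contract_subgraph_def)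
  have rel: "(?\<pi> v, ?\<pi> w) \<in> conn_rel ?q \<longleftrightarrow> (v, w) \<in> (adjacent \<gamma>)\<^sup>*"
    if "v \<in> verts G" "w \<in> verts G" for v w
    using reachable_contract_iff[OF f\<gamma> \<delta>, of v w] that C(1) by (auto simp: conn_rel_def verts adj)
  have union: "\<Union> (?\<kappa> v) = conn_rel \<gamma> `` {v}" if v: "v \<in> verts G" for v
  proof (intro subset_antisym subsetI)
    fix u assume "u \<in> \<Union> (?\<kappa> v)"
    then obtain w where w: "w \<in> verts G" "(?\<pi> v, ?\<pi> w) \<in> conn_rel ?q" "(w, u) \<in> conn_rel \<delta>"
      using conn_rel_subset[of ?q] unfolding verts by auto
    have "(w, u) \<in> (adjacent \<gamma>)\<^sup>*"
      using w(3) rtrancl_mono[OF adjacent_covering_subset[OF \<delta>]] by (auto simp: conn_rel_def)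
    with w rel[OF v w(1)] have "(v, u) \<in> (adjacent \<gamma>)\<^sup>*" by auto
    then show "u \<in> conn_rel \<gamma> `` {v}" using v C(1) by (simp add: conn_class[OF f\<gamma>])
  next
    fix u assume "u \<in> conn_rel \<gamma> `` {v}"
    then have u: "u \<in> verts G" "(v, u) \<in> (adjacent \<gamma>)\<^sup>*" using C(1) by (auto simp: conn_rel_def)
    then have "?\<pi> u \<in> ?\<kappa> v" using rel[OF v] by simp
    moreover have "u \<in> ?\<pi> u" using u(1) C(1) D(1) conn_rel_refl[of u \<delta>] by simp
    ultimately show "u \<in> \<Union> (?\<kappa> v)" by blast
  qed
  have fq: "feynman_graph ?q"
    by (rule feynman_graph_covering[OF feynman_graph_contract[OF G covering_subgraph_trans[OF \<delta> \<gamma>]]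
          contract_subgraph_covering[OF G \<gamma> \<delta>]])
  have comp: "components ?q = ?\<kappa> ` verts G"
    by (simp add: components_image verts image_image)
  have "bij_betw Union (components ?q) (components \<gamma>)"
  proof (rule bij_betw_imageI)
    show "inj_on Union (components ?q)"
    proof (rule inj_onI)
      fix X Y assume "X \<in> components ?q" "Y \<in> components ?q" and eq: "\<Union> X = \<Union> Y"
      then obtain v w where v: "v \<in> verts G" "X = ?\<kappa> v" and w: "w \<in> verts G" "Y = ?\<kappa> w"
        unfolding comp by blast
      then have "(v, w) \<in> (adjacent \<gamma>)\<^sup>*"
        using eq union conn_class_eq_iff[OF f\<gamma>] C(1) by simp
      then have "(?\<pi> v, ?\<pi> w) \<in> (adjacent ?q)\<^sup>*"
        using rel[OF v(1) w(1)] by (simp add: conn_rel_def)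
      then show "X = Y" using conn_class_eq_iff[OF fq, of "?\<pi> v" "?\<pi> w"] v w verts by simp
    qed
    show "Union ` components ?q = components \<gamma>"
      unfolding comp image_image components_image[of \<gamma>] using union C(1) by simp
  qed
  moreover have "invol \<delta> e = e" if "e \<in> hedges G" "invol \<gamma> e = e" for e
    using C(2) D(6)[of e] that by simp
  then have "{e \<in> hedges (contract G \<delta>). invol ?q e = e} = {e \<in> hedges G. invol \<gamma> e = e}"
    by (auto simp: contract_subgraph_def)
  ultimately show ?thesis using union F(5) by (simp add: is_iso_def)
qed

section \<open>Disjoint unions\<close>

lemma disjoint_union_simps [simp]:
  "verts (disjoint_union G H) = verts G <+> verts H"
  "hedges (disjoint_union G H) = hedges G <+> hedges H"
  "invol (disjoint_union G H) = map_sum (invol G) (invol H)"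
  "att (disjoint_union G H) = map_sum (att G) (att H)"
  "htype (disjoint_union G H) = case_sum (htype G) (htype H)"
  by (simp_all add: disjoint_union_def)

lemma Inl_Inr_mem_Plus [simp]:
  "Inl a \<in> A <+> B \<longleftrightarrow> a \<in> A" "Inr b \<in> A <+> B \<longleftrightarrow> b \<in> B"
  by auto

lemma adjacent_disjoint_union:
  "(Inl v, x) \<in> adjacent (disjoint_union G H) \<longleftrightarrow> (\<exists>w. x = Inl w \<and> (v, w) \<in> adjacent G)"
  "(Inr v', x) \<in> adjacent (disjoint_union G H) \<longleftrightarrow> (\<exists>w. x = Inr w \<and> (v', w) \<in> adjacent H)"
  by (force simp: adjacent_def)+

lemma reachable_disjoint_union_Inl:
  "(Inl v, x) \<in> (adjacent (disjoint_union G H))\<^sup>* \<longleftrightarrow> (\<exists>w. x = Inl w \<and> (v, w) \<in> (adjacent G)\<^sup>*)"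
    (is "?l \<longleftrightarrow> ?r")
proof
  assume ?l
  then show ?r
  proof induction
    case (step y z)
    then obtain w where w: "y = Inl w" "(v, w) \<in> (adjacent G)\<^sup>*" by blast
    from step.hyps(2)[unfolded w(1) adjacent_disjoint_union]
    obtain u where "z = Inl u" "(w, u) \<in> adjacent G" by blast
    with w(2) show ?case by (auto intro: rtrancl_into_rtrancl)
  qed simp
next
  assume ?r
  then obtain w where "x = Inl w" "(v, w) \<in> (adjacent G)\<^sup>*" by blast
  from this(2) have "(Inl v, Inl w) \<in> (adjacent (disjoint_union G H))\<^sup>*"
  proof induction
    case (step y z)
    then have "(Inl y, Inl z) \<in> adjacent (disjoint_union G H)"
      by (simp add: adjacent_disjoint_union)
    with step.IH show ?case by (rule rtrancl_into_rtrancl)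
  qed simp
  then show ?l using \<open>x = Inl w\<close> by simp
qed

lemma reachable_disjoint_union_Inr:
  "(Inr v, x) \<in> (adjacent (disjoint_union G H))\<^sup>* \<longleftrightarrow> (\<exists>w. x = Inr w \<and> (v, w) \<in> (adjacent H)\<^sup>*)"
    (is "?l \<longleftrightarrow> ?r")
proof
  assume ?l
  then show ?r
  proof induction
    case (step y z)
    then obtain w where w: "y = Inr w" "(v, w) \<in> (adjacent H)\<^sup>*" by blast
    from step.hyps(2)[unfolded w(1) adjacent_disjoint_union]
    obtain u where "z = Inr u" "(w, u) \<in> adjacent H" by blast
    with w(2) show ?case by (auto intro: rtrancl_into_rtrancl)
  qed simp
next
  assume ?r
  then obtain w where "x = Inr w" "(v, w) \<in> (adjacent H)\<^sup>*" by blast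
  from this(2) have "(Inr v, Inr w) \<in> (adjacent (disjoint_union G H))\<^sup>*"
  proof induction
    case (step y z)
    then have "(Inr y, Inr z) \<in> adjacent (disjoint_union G H)"
      by (simp add: adjacent_disjoint_union)
    with step.IH show ?case by (rule rtrancl_into_rtrancl)
  qed simp
  then show ?l using \<open>x = Inr w\<close> by simp
qed

lemma conn_class_disjoint_union:
  "conn_rel (disjoint_union G H) `` {Inl v} = Inl ` (conn_rel G `` {v})"
  "conn_rel (disjoint_union G H) `` {Inr w} = Inr ` (conn_rel H `` {w})"
  by (auto simp: conn_rel_def reachable_disjoint_union_Inl reachable_disjoint_union_Inr)

lemma components_disjoint_union:
  "components (disjoint_union G H) = (`) Inl ` components G \<union> (`) Inr ` components H"
  by (simp add: components_image Plus_def image_Un image_image conn_class_disjoint_union)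

lemma cut_disjoint_union:
  "cut (Inl e) (disjoint_union G H) = disjoint_union (cut e G) H"
  "cut (Inr e') (disjoint_union G H) = disjoint_union G (cut e' H)"
proof -
  have "((map_sum (invol G) (invol H))(Inl e := Inl e, Inl (invol G e) := Inl (invol G e))) x =
      map_sum ((invol G)(e := e, invol G e := invol G e)) (invol H) x" for x
    by (cases x) auto
  moreover have
    "((map_sum (invol G) (invol H))(Inr e' := Inr e', Inr (invol H e') := Inr (invol H e'))) x =
      map_sum (invol G) ((invol H)(e' := e', invol H e' := invol H e')) x" for x
    by (cases x) auto
  ultimately show
    "cut (Inl e) (disjoint_union G H) = disjoint_union (cut e G) H"
    "cut (Inr e') (disjoint_union G H) = disjoint_union G (cut e' H)"
    by (simp_all add: cut_def disjoint_union_def fun_eq_iff)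
qed

lemma locally_1PI_disjoint_union:
  assumes "feynman_graph G" "feynman_graph H"
  shows "locally_1PI (disjoint_union G H) \<longleftrightarrow> locally_1PI G \<and> locally_1PI H"
  unfolding locally_1PI_iff[OF assms(1)] locally_1PI_iff[OF assms(2)]
    locally_1PI_iff[OF feynman_graph_disjoint_union[OF assms]]
  by (simp add: Plus_def ball_Un cut_disjoint_union reachable_disjoint_union_Inl
      reachable_disjoint_union_Inr)

lemma vertex_type_disjoint_union:
  "vertex_type (disjoint_union G H) (Inl v) = vertex_type G v"
  "vertex_type (disjoint_union G H) (Inr w) = vertex_type H w"
proof -
  have "{e \<in> star (disjoint_union G H) (Inl v). htype (disjoint_union G H) e = t} =
      Inl ` {e \<in> star G v. htype G e = t}"
    "{e \<in> star (disjoint_union G H) (Inr w). htype (disjoint_union G H) e = t} =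
      Inr ` {e \<in> star H w. htype H e = t}" for t
    by (auto simp: star_def)
  then show "vertex_type (disjoint_union G H) (Inl v) = vertex_type G v"
    "vertex_type (disjoint_union G H) (Inr w) = vertex_type H w"
    by (simp_all add: vertex_type_def card_image)
qed

lemma in_theory_disjoint_union:
  "in_theory E V (disjoint_union G H) \<longleftrightarrow> in_theory E V G \<and> in_theory E V H"
  by (auto simp: in_theory_def Plus_def ball_Un vertex_type_disjoint_union)

lemma iso_contract_disjoint_union:
  assumes G: "feynman_graph G" and H: "feynman_graph H"
  shows "is_iso (case_sum ((`) Inl) ((`) Inr)) id
    (disjoint_union (contract G \<gamma>) (contract H \<eta>)) (contract (disjoint_union G H) (disjoint_union \<gamma> \<eta>))"
proof -
  let ?f = "case_sum ((`) Inl) ((`) Inr) :: 'a set + 'd set \<Rightarrow> ('a + 'd) set"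
  have "X = {}" if "Inl ` X = Inr ` Y" for X :: "'a set" and Y :: "'d set"
    using that by blast
  then have "inj_on ?f (components \<gamma> <+> components \<eta>)"
    using component_nonempty by (fastforce simp: inj_on_def inj_image_eq_iff)
  moreover have "?f ` (components \<gamma> <+> components \<eta>) = components (disjoint_union \<gamma> \<eta>)"
    by (simp add: components_disjoint_union Plus_def image_Un image_image)
  moreover have "{e \<in> hedges G <+> hedges H. map_sum (invol \<gamma>) (invol \<eta>) e = e} =
      {e \<in> hedges G. invol \<gamma> e = e} <+> {e \<in> hedges H. invol \<eta> e = e}"
    by auto
  moreover have "conn_rel (disjoint_union \<gamma> \<eta>) `` {map_sum (att G) (att H) e} =
      ?f (map_sum (\<lambda>e. conn_rel \<gamma> `` {att G e}) (\<lambda>e. conn_rel \<eta> `` {att H e}) e)" for e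
    by (cases e) (simp_all add: conn_class_disjoint_union)
  ultimately show ?thesis
    by (simp add: is_iso_def bij_betw_def)
qed

lemma disjoint_union_covering:
  assumes "\<gamma> \<in> covering_subgraphs G" "\<eta> \<in> covering_subgraphs H"
  shows "disjoint_union \<gamma> \<eta> \<in> covering_subgraphs (disjoint_union G H)"
proof (rule covering_subgraphI)
  note C = covering_subgraphD[OF assms(1)] and D = covering_subgraphD[OF assms(2)]
  show "invol (disjoint_union \<gamma> \<eta>) e = invol (disjoint_union G H) e"
    if "e \<notin> hedges (disjoint_union G H)" for e
    using that C(5) D(5) by (cases e) auto
  show "invol (disjoint_union \<gamma> \<eta>) e \<in> {e, invol (disjoint_union G H) e}"
    if "e \<in> hedges (disjoint_union G H)" for e
    using that C(6) D(6) by (cases e) auto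
  show "invol (disjoint_union \<gamma> \<eta>) (invol (disjoint_union G H) e) = invol (disjoint_union G H) e"
    if "e \<in> hedges (disjoint_union G H)" "invol (disjoint_union \<gamma> \<eta>) e = e" for e
    using that C(7) D(7) by (cases e) auto
qed (use covering_subgraphD(1-4)[OF assms(1)] covering_subgraphD(1-4)[OF assms(2)] in simp_all)

definition left_subgraph ::
  "('v, 'h, 't) fgraph \<Rightarrow> ('v + 'w, 'h + 'k, 't) fgraph \<Rightarrow> ('v, 'h, 't) fgraph" where
  "left_subgraph G \<theta> = G\<lparr>invol := (\<lambda>e. projl (invol \<theta> (Inl e)))\<rparr>"

definition right_subgraph ::
  "('w, 'k, 't) fgraph \<Rightarrow> ('v + 'w, 'h + 'k, 't) fgraph \<Rightarrow> ('w, 'k, 't) fgraph" where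
  "right_subgraph H \<theta> = H\<lparr>invol := (\<lambda>e. projr (invol \<theta> (Inr e)))\<rparr>"

lemma subgraphs_disjoint_union:
  assumes "\<gamma> \<in> covering_subgraphs G" "\<eta> \<in> covering_subgraphs H"
  shows "left_subgraph G (disjoint_union \<gamma> \<eta>) = \<gamma>" "right_subgraph H (disjoint_union \<gamma> \<eta>) = \<eta>"
  using covering_subgraphD(8)[OF assms(1)] covering_subgraphD(8)[OF assms(2)]
  by (simp_all add: left_subgraph_def right_subgraph_def)

lemma covering_disjoint_unionE:
  assumes \<theta>: "\<theta> \<in> covering_subgraphs (disjoint_union G H)"
  shows "left_subgraph G \<theta> \<in> covering_subgraphs G" "right_subgraph H \<theta> \<in> covering_subgraphs H"
    "disjoint_union (left_subgraph G \<theta>) (right_subgraph H \<theta>) = \<theta>"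
proof -
  note C = covering_subgraphD[OF \<theta>]
  have Inl: "invol \<theta> (Inl e) = Inl e \<or> invol \<theta> (Inl e) = Inl (invol G e)" for e
    using C(5,6)[of "Inl e"] by (cases "e \<in> hedges G") auto
  have Inr: "invol \<theta> (Inr e) = Inr e \<or> invol \<theta> (Inr e) = Inr (invol H e)" for e
    using C(5,6)[of "Inr e"] by (cases "e \<in> hedges H") auto
  show "left_subgraph G \<theta> \<in> covering_subgraphs G"
  proof (rule covering_subgraphI)
    show "e \<notin> hedges G \<Longrightarrow> invol (left_subgraph G \<theta>) e = invol G e" for e
      using C(5)[of "Inl e"] by (simp add: left_subgraph_def)
    show "e \<in> hedges G \<Longrightarrow> invol (left_subgraph G \<theta>) e \<in> {e, invol G e}" for e
      using Inl[of e] by (auto simp: left_subgraph_def)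
    show "invol (left_subgraph G \<theta>) (invol G e) = invol G e"
      if "e \<in> hedges G" "invol (left_subgraph G \<theta>) e = e" for e
    proof -
      have "invol \<theta> (Inl e) = Inl e" using Inl[of e] that(2) by (auto simp: left_subgraph_def)
      then show ?thesis using C(7)[of "Inl e"] that(1) by (auto simp: left_subgraph_def)
    qed
  qed (simp_all add: left_subgraph_def)
  show "right_subgraph H \<theta> \<in> covering_subgraphs H"
  proof (rule covering_subgraphI)
    show "e \<notin> hedges H \<Longrightarrow> invol (right_subgraph H \<theta>) e = invol H e" for e
      using C(5)[of "Inr e"] by (simp add: right_subgraph_def)
    show "e \<in> hedges H \<Longrightarrow> invol (right_subgraph H \<theta>) e \<in> {e, invol H e}" for e
      using Inr[of e] by (auto simp: right_subgraph_def)
    show "invol (right_subgraph H \<theta>) (invol H e) = invol H e"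
      if "e \<in> hedges H" "invol (right_subgraph H \<theta>) e = e" for e
    proof -
      have "invol \<theta> (Inr e) = Inr e" using Inr[of e] that(2) by (auto simp: right_subgraph_def)
      then show ?thesis using C(7)[of "Inr e"] that(1) by (auto simp: right_subgraph_def)
    qed
  qed (simp_all add: right_subgraph_def)
  have "invol (disjoint_union (left_subgraph G \<theta>) (right_subgraph H \<theta>)) x = invol \<theta> x" for x
  proof (cases x)
    case (Inl e)
    then show ?thesis using \<open>\<And>e. invol \<theta> (Inl e) = Inl e \<or> _\<close>[of e] by (auto simp: left_subgraph_def)
  next
    case (Inr e)
    then show ?thesis using \<open>\<And>e. invol \<theta> (Inr e) = Inr e \<or> _\<close>[of e] by (auto simp: right_subgraph_def)
  qed
  then show "disjoint_union (left_subgraph G \<theta>) (right_subgraph H \<theta>) = \<theta>"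
    using C(1-4) by (intro fgraph.equality) (auto simp: left_subgraph_def right_subgraph_def)
qed

section \<open>Isomorphism classes\<close>

definition divergent_graph :: "'t set \<Rightarrow> ('t \<Rightarrow> nat) set \<Rightarrow> ('v, 'h, 't) fgraph \<Rightarrow> bool" where
  "divergent_graph E V G \<longleftrightarrow> in_theory E V G \<and> locally_1PI G \<and> in_theory E V (contract G G)"

lemma divergent_graph_isomorphic:
  assumes G: "feynman_graph G" and "G \<simeq> H" and "divergent_graph E V G"
  shows "divergent_graph E V H"
proof -
  obtain f g where iso: "is_iso f g G H" using assms(2) unfolding isomorphic_def by blast
  note I = is_isoD[OF iso] and F = feynman_graphD[OF G]
  have "invol H (g e) = g e \<longleftrightarrow> invol G e = e" if "e \<in> hedges G" for e
    using I(3)[OF that] I(2) F(3)[OF that] that by (metis bij_betw_imp_inj_on inj_on_eq_iff)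
  then have "bij_betw g {e \<in> hedges G. invol G e = e} {e \<in> hedges H. invol H e = e}"
    by (rule bij_betw_Collect_iff[OF I(2)])
  then have "is_iso ((`) f) g (contract G G) (contract H H)"
    using iso_bij_components[OF iso G] iso_conn_class[OF iso G] I F by (simp add: is_iso_def)
  then show ?thesis
    using assms(3) iso_in_theory[OF iso G] iso_locally_1PI[OF iso G]
      iso_in_theory[OF _ feynman_graph_contract[OF G covering_subgraph_self[OF G]]]
    unfolding divergent_graph_def by blast
qed

lemma divergent_classes_eq:
  "divergent_classes E V = {iso_class G | G :: (nat, nat, 't) fgraph.
     feynman_graph G \<and> divergent_graph E V G}"
  unfolding divergent_classes_def divergent_graph_def
  using superficially_divergent_iff_in_theory by blast

lemma iso_class_mem_divergent_classes:
  assumes "feynman_graph G"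
  shows "iso_class G \<in> divergent_classes E V \<longleftrightarrow> divergent_graph E V G"
proof
  assume "iso_class G \<in> divergent_classes E V"
  then obtain H :: "(nat, nat, 'c) fgraph" where
    H: "feynman_graph H" "divergent_graph E V H" "iso_class H = iso_class G"
    by (auto simp: divergent_classes_eq)
  then show "divergent_graph E V G"
    using divergent_graph_isomorphic iso_class_eq_iff assms by blast
next
  assume D: "divergent_graph E V G"
  note n = nat_copy[OF assms]
  have "divergent_graph E V (nat_copy G)" by (rule divergent_graph_isomorphic[OF assms n(2) D])
  moreover have "iso_class G = iso_class (nat_copy G)"
    using iso_class_eq_iff[OF assms n(1)] n(2) by blast
  ultimately show "iso_class G \<in> divergent_classes E V"
    using n(1) by (auto simp: divergent_classes_eq)
qed

lemma divergent_classesE: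
  assumes "x \<in> divergent_classes E V"
  obtains G :: "(nat, nat, 't) fgraph" where
    "x = iso_class G" "feynman_graph G" "divergent_graph E V G"
  using assms by (auto simp: divergent_classes_eq)

lemma is_iso_imp_iso_class_eq:
  assumes "feynman_graph G" "is_iso f g G H"
  shows "iso_class G = iso_class H"
  using iso_class_eq_iff[OF assms(1) iso_feynman_graph[OF assms]] assms(2)
  by (auto simp: isomorphic_def)

lemma is_iso_in_theory_iff:
  assumes "feynman_graph G" "is_iso f g G H"
  shows "in_theory E V G \<longleftrightarrow> in_theory E V H"
  using iso_in_theory[OF assms(2,1)]
    iso_in_theory[OF iso_sym[OF assms] iso_feynman_graph[OF assms]] by blast

lemma is_iso_locally_1PI_iff:
  assumes "feynman_graph G" "is_iso f g G H"
  shows "locally_1PI G \<longleftrightarrow> locally_1PI H"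
  using iso_locally_1PI[OF assms(2,1)]
    iso_locally_1PI[OF iso_sym[OF assms] iso_feynman_graph[OF assms]] by blast

lemma divergent_graph_disjoint_union:
  assumes G: "feynman_graph G" and H: "feynman_graph H"
    and "divergent_graph E V G" "divergent_graph E V H"
  shows "divergent_graph E V (disjoint_union G H)"
proof -
  have "feynman_graph (disjoint_union (contract G G) (contract H H))"
    by (intro feynman_graph_disjoint_union feynman_graph_contract covering_subgraph_self G H)
  from is_iso_in_theory_iff[OF this iso_contract_disjoint_union[OF G H]]
  show ?thesis
    using assms(3,4)
    unfolding divergent_graph_def in_theory_disjoint_union locally_1PI_disjoint_union[OF G H]
    by blast
qed

lemma divergent_graph_empty: "divergent_graph E V empty_graph"
  by (simp add: divergent_graph_def in_theory_def locally_1PI_def components_def contract_def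
      empty_graph_def)

definition admissible_subgraphs ::
  "'t set \<Rightarrow> ('t \<Rightarrow> nat) set \<Rightarrow> ('v, 'h, 't) fgraph \<Rightarrow> ('v, 'h, 't) fgraph set" where
  "admissible_subgraphs E V G =
     {\<gamma> \<in> covering_subgraphs G. locally_1PI \<gamma> \<and> in_theory E V (contract G \<gamma>)}"

lemma admissible_subgraphsD:
  assumes "\<gamma> \<in> admissible_subgraphs E V G"
  shows "\<gamma> \<in> covering_subgraphs G" "locally_1PI \<gamma>" "in_theory E V (contract G \<gamma>)"
    "feynman_graph G \<Longrightarrow> feynman_graph \<gamma>" "feynman_graph G \<Longrightarrow> feynman_graph (contract G \<gamma>)"
  using assms feynman_graph_covering feynman_graph_contract by (auto simp: admissible_subgraphs_def)

lemma finite_admissible_subgraphs: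
  "feynman_graph G \<Longrightarrow> finite (admissible_subgraphs E V G)"
  by (simp add: admissible_subgraphs_def finite_covering_subgraphs)

lemma in_theory_contract_covering:
  assumes "\<gamma> \<in> covering_subgraphs G"
  shows "in_theory E V (contract \<gamma> \<delta>) \<longleftrightarrow> in_theory E V (contract G \<delta>)"
  using covering_subgraphD(1-4)[OF assms]
  by (simp add: in_theory_def vertex_type_def star_def)

lemma divergent_graph_subgraph:
  assumes G: "feynman_graph G" "in_theory E V G" and \<gamma>: "\<gamma> \<in> admissible_subgraphs E V G"
  shows "divergent_graph E V \<gamma>"
proof -
  note A = admissible_subgraphsD[OF \<gamma>]
  have "in_theory E V \<gamma>"
    using G(2) covering_subgraphD(1-4)[OF A(1)]
    by (simp add: in_theory_def vertex_type_def star_def)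
  then show ?thesis
    using A(2,3) in_theory_contract_covering[OF A(1)] by (simp add: divergent_graph_def)
qed

lemma divergent_graph_contract:
  assumes G: "feynman_graph G" "divergent_graph E V G" and \<gamma>: "\<gamma> \<in> admissible_subgraphs E V G"
  shows "divergent_graph E V (contract G \<gamma>)"
proof -
  note A = admissible_subgraphsD[OF \<gamma>]
  have "contract_subgraph G \<gamma> G = contract G \<gamma>"
    by (simp add: contract_subgraph_def contract_def)
  then have "is_iso Union id (contract (contract G \<gamma>) (contract G \<gamma>)) (contract G G)"
    using iso_contract_contract[OF G(1) covering_subgraph_self[OF G(1)] A(1)] by simp
  from is_iso_in_theory_iff[OF feynman_graph_contract[OF A(5)[OF G(1)]
        covering_subgraph_self[OF A(5)[OF G(1)]]] this]
  show ?thesis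
    using A(3) G(2) locally_1PI_contract[OF G(1) A(1)] by (simp add: divergent_graph_def)
qed

lemma admissible_nested_iff:
  assumes G: "feynman_graph G" and \<gamma>: "\<gamma> \<in> covering_subgraphs G" and \<delta>: "\<delta> \<in> covering_subgraphs \<gamma>"
  shows "\<gamma> \<in> admissible_subgraphs E V G \<and> \<delta> \<in> admissible_subgraphs E V \<gamma> \<longleftrightarrow>
    \<delta> \<in> admissible_subgraphs E V G \<and>
    contract_subgraph G \<delta> \<gamma> \<in> admissible_subgraphs E V (contract G \<delta>)"
proof -
  note f\<gamma> = feynman_graph_covering[OF G \<gamma>]
  note \<delta>G = covering_subgraph_trans[OF \<delta> \<gamma>]
  note cs = contract_subgraph_covering[OF G \<gamma> \<delta>]
  have "locally_1PI (contract \<gamma> \<delta>) \<longleftrightarrow> locally_1PI (contract_subgraph G \<delta> \<gamma>)"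
    by (rule is_iso_locally_1PI_iff[OF feynman_graph_contract[OF f\<gamma> \<delta>] iso_contract_subgraph[OF \<gamma>]])
  moreover have "in_theory E V (contract (contract G \<delta>) (contract_subgraph G \<delta> \<gamma>)) \<longleftrightarrow>
      in_theory E V (contract G \<gamma>)"
    by (rule is_iso_in_theory_iff[OF feynman_graph_contract[OF feynman_graph_contract[OF G \<delta>G] cs]
          iso_contract_contract[OF G \<gamma> \<delta>]])
  ultimately show ?thesis
    using locally_1PI_contract[OF f\<gamma> \<delta>] locally_1PI_of_contract[OF f\<gamma> \<delta>]
      in_theory_contract_covering[OF \<gamma>] \<gamma> \<delta> \<delta>G cs
    unfolding admissible_subgraphs_def by blast
qed

definition discrete_subgraph :: "('v, 'h, 't) fgraph \<Rightarrow> ('v, 'h, 't) fgraph" where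
  "discrete_subgraph G = G\<lparr>invol := (\<lambda>e. if e \<in> hedges G then e else invol G e)\<rparr>"

lemma discrete_subgraph_unique:
  assumes "\<gamma> \<in> covering_subgraphs G" "\<forall>e\<in>hedges \<gamma>. invol \<gamma> e = e"
  shows "\<gamma> = discrete_subgraph G"
proof -
  note C = covering_subgraphD[OF assms(1)]
  have "invol \<gamma> = (\<lambda>e. if e \<in> hedges G then e else invol G e)"
    using C(2,5) assms(2) by auto
  then show ?thesis using C(8) unfolding discrete_subgraph_def by metis
qed

lemma discrete_subgraph:
  assumes G: "feynman_graph G"
  shows "discrete_subgraph G \<in> covering_subgraphs G" "locally_1PI (discrete_subgraph G)"
    "is_iso (\<lambda>v. {v}) id G (contract G (discrete_subgraph G))"
    "\<forall>e\<in>hedges (discrete_subgraph G). invol (discrete_subgraph G) e = e"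
proof -
  note F = feynman_graphD[OF G]
  show C: "discrete_subgraph G \<in> covering_subgraphs G"
    by (rule covering_subgraphI) (use F(3) in \<open>auto simp: discrete_subgraph_def\<close>)
  show fixed: "\<forall>e\<in>hedges (discrete_subgraph G). invol (discrete_subgraph G) e = e"
    by (simp add: discrete_subgraph_def)
  show "locally_1PI (discrete_subgraph G)"
    using fixed by (simp add: locally_1PI_iff[OF feynman_graph_covering[OF G C]])
  have "adjacent (discrete_subgraph G) = {}"
    using fixed by (auto simp: adjacent_def)
  then have conn: "conn_rel (discrete_subgraph G) `` {v} = {v}" if "v \<in> verts G" for v
    using that by (auto simp: conn_rel_def discrete_subgraph_def)
  then have "components (discrete_subgraph G) = (\<lambda>v. {v}) ` verts G"
    by (simp add: components_image discrete_subgraph_def cong: image_cong)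
  moreover have "{e \<in> hedges G. invol (discrete_subgraph G) e = e} = hedges G"
    by (auto simp: discrete_subgraph_def)
  ultimately show "is_iso (\<lambda>v. {v}) id G (contract G (discrete_subgraph G))"
    using F(5) conn by (simp add: is_iso_def bij_betw_def)
qed

definition edgeless_class :: "'t igraph \<Rightarrow> bool" where
  "edgeless_class x \<longleftrightarrow> (\<exists>G :: (nat, nat, 't) fgraph.
     feynman_graph G \<and> x = iso_class G \<and> (\<forall>e\<in>hedges G. invol G e = e))"

lemma isomorphic_edgeless:
  assumes "G \<simeq> H" "\<forall>e\<in>hedges G. invol G e = e"
  shows "\<forall>e\<in>hedges H. invol H e = e"
proof -
  obtain f g where "is_iso f g G H" using assms(1) by (auto simp: isomorphic_def)
  note I = is_isoD[OF this]
  have "hedges H = g ` hedges G" using I(2) by (simp add: bij_betw_def)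
  then show ?thesis using I(3) assms(2) by auto
qed

lemma edgeless_class_iff:
  assumes "feynman_graph G"
  shows "edgeless_class (iso_class G) \<longleftrightarrow> (\<forall>e\<in>hedges G. invol G e = e)"
proof
  assume "edgeless_class (iso_class G)"
  then show "\<forall>e\<in>hedges G. invol G e = e"
    unfolding edgeless_class_def using isomorphic_edgeless iso_class_eq_iff assms by metis
next
  assume "\<forall>e\<in>hedges G. invol G e = e"
  then have "\<forall>e\<in>hedges (nat_copy G). invol (nat_copy G) e = e"
    using isomorphic_edgeless[OF nat_copy(2)[OF assms]] by blast
  moreover have "iso_class G = iso_class (nat_copy G)"
    using iso_class_eq_iff[OF assms nat_copy(1)[OF assms]] nat_copy(2)[OF assms] by blast
  ultimately show "edgeless_class (iso_class G)"
    unfolding edgeless_class_def using nat_copy(1)[OF assms] by blast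
qed

section \<open>Linear maps on free spaces\<close>

lemma linear_on_eqI:
  fixes f g :: "('b \<Rightarrow>\<^sub>0 'k::field) \<Rightarrow> 'w::ab_group_add"
  assumes "vector_space s" "linear_on (free_space B) s f" "linear_on (free_space B) s g"
    and "\<And>x. x \<in> B \<Longrightarrow> f (basis_vector x) = g (basis_vector x)" and a: "a \<in> free_space B"
  shows "f a = g a"
proof -
  have "f (basis_vector x) = g (basis_vector x)" if "x \<in> Poly_Mapping.keys a" for x
    using assms(4) a that by (auto simp: free_space_def)
  then show ?thesis
    unfolding linear_on_extension[OF assms(2,1) a] linear_on_extension[OF assms(3,1) a]
    by (simp add: linear_extension_def)
qed

lemma linear_extension_sum:
  assumes "vector_space s"
  shows "linear_extension s f (sum p A) = (\<Sum>x\<in>A. linear_extension s f (p x))"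
proof (induction A rule: infinite_finite_induct)
  case (insert x A)
  then show ?case by (simp add: linear_extension_add[OF assms])
qed (simp_all add: linear_extension_def)

lemma linear_on_comp:
  assumes "linear_on S scale f" "linear_on UNIV s g"
  shows "linear_on S s (\<lambda>a. g (f a))"
  using assms by (simp add: linear_on_def)

lemma tensor_map_sum_basis:
  "tensor_map f g (\<Sum>i\<in>A. basis_vector (x i, y i)) =
    (\<Sum>i\<in>A. tensor (f (basis_vector (x i))) (g (basis_vector (y i))))"
  by (simp add: tensor_map_def linear_extension_sum[OF scale.vector_space_axioms]
      linear_extension_basis[OF scale.vector_space_axioms])

lemma tensor_sum_left: "tensor (\<Sum>i\<in>A. p i) q = (\<Sum>i\<in>A. tensor (p i) q)"
  by (induction A rule: infinite_finite_induct) (simp_all add: tensor_add_left, simp_all add: tensor_def)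

lemma tensor_sum_right: "tensor q (\<Sum>i\<in>A. p i) = (\<Sum>i\<in>A. tensor q (p i))"
  by (induction A rule: infinite_finite_induct) (simp_all add: tensor_add_right, simp_all add: tensor_def)

lemma vector_space_mult: "vector_space ((*) :: 'k::field \<Rightarrow> 'k \<Rightarrow> 'k)"
  by unfold_locales (simp_all add: algebra_simps)

lemma multiplicative_onI:
  fixes f :: "('b::comm_monoid_add \<Rightarrow>\<^sub>0 'k::field) \<Rightarrow> 'w::comm_ring_1"
  assumes s: "vector_space s" "\<And>c u v. s c u * v = s c (u * v)"
    and f: "linear_on UNIV s f"
    and basis: "\<And>x y. x \<in> B \<Longrightarrow> y \<in> B \<Longrightarrow>
      f (basis_vector (x + y)) = f (basis_vector x) * f (basis_vector y)"
    and a: "a \<in> free_space B" and b: "b \<in> free_space B"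
  shows "f (a * b) = f a * f b"
proof -
  note L = f[unfolded linear_on_def]
  have s': "u * s c v = s c (u * v)" for c u v
    using s(2)[of c v u] by (simp add: mult.commute)
  have left_basis: "f (basis_vector x * b) = f (basis_vector x) * f b" if "x \<in> B" for x
  proof (rule linear_on_eqI[OF s(1) _ _ _ b])
    show "linear_on (free_space B) s (\<lambda>b. f (basis_vector x * b))"
      using L by (simp add: linear_on_def distrib_left scale_mult)
    show "linear_on (free_space B) s (\<lambda>b. f (basis_vector x) * f b)"
      using L by (simp add: linear_on_def distrib_left s')
    show "f (basis_vector x * basis_vector y) = f (basis_vector x) * f (basis_vector y)"
      if "y \<in> B" for y
      using basis[OF \<open>x \<in> B\<close> that] by (simp add: mult_single)
  qed
  show ?thesis
  proof (rule linear_on_eqI[OF s(1) _ _ _ a])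
    show "linear_on (free_space B) s (\<lambda>a. f (a * b))"
      using L by (simp add: linear_on_def distrib_right scale_mult)
    show "linear_on (free_space B) s (\<lambda>a. f a * f b)"
      using L by (simp add: linear_on_def distrib_right s(2))
  qed (rule left_basis)
qed

section \<open>The bialgebra\<close>

lemma coproduct_basis:
  assumes "feynman_graph G"
  shows "coproduct E V (basis_vector (iso_class G)) =
    (\<Sum>\<gamma>\<in>admissible_subgraphs E V G. basis_vector (iso_class \<gamma>, iso_class (contract G \<gamma>)))"
  by (simp add: coproduct_graph[OF assms] graph_coproduct_def admissible_subgraphs_def)

lemma coproduct_coassoc_basis:
  assumes G: "feynman_graph G"
  defines "x \<equiv> basis_vector (iso_class G)"
  shows "tensor_assoc (tensor_map (coproduct E V) id (coproduct E V x)) =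
    tensor_map id (coproduct E V) (coproduct E V x)"
proof -
  let ?A = "admissible_subgraphs E V"
  have "tensor_assoc (tensor_map (coproduct E V) id (coproduct E V x)) =
      tensor_assoc (\<Sum>\<gamma>\<in>?A G. \<Sum>\<delta>\<in>?A \<gamma>.
        basis_vector ((iso_class \<delta>, iso_class (contract \<gamma> \<delta>)), iso_class (contract G \<gamma>)))"
    unfolding x_def coproduct_basis[OF G] tensor_map_sum_basis
    by (intro arg_cong[of _ _ tensor_assoc] sum.cong refl)
      (simp add: coproduct_basis[OF admissible_subgraphsD(4)[OF _ G]] tensor_sum_left)
  also have "\<dots> = (\<Sum>\<gamma>\<in>?A G. \<Sum>\<delta>\<in>?A \<gamma>.
        basis_vector (iso_class \<delta>, iso_class (contract \<gamma> \<delta>), iso_class (contract G \<gamma>)))"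
    by (simp add: tensor_assoc_def linear_extension_sum[OF scale.vector_space_axioms]
        linear_extension_basis[OF scale.vector_space_axioms])
  also have "\<dots> = (\<Sum>(\<gamma>, \<delta>)\<in>(SIGMA \<gamma>:?A G. ?A \<gamma>).
        basis_vector (iso_class \<delta>, iso_class (contract \<gamma> \<delta>), iso_class (contract G \<gamma>)))"
    by (rule sum.Sigma) (auto intro: finite_admissible_subgraphs G admissible_subgraphsD(4)[OF _ G])
  also have "\<dots> = (\<Sum>(\<delta>, \<gamma>')\<in>(SIGMA \<delta>:?A G. ?A (contract G \<delta>)).
        basis_vector (iso_class \<delta>, iso_class \<gamma>', iso_class (contract (contract G \<delta>) \<gamma>')))"
  proof (rule sum.reindex_bij_witness[where i = "\<lambda>(\<delta>, \<gamma>'). (expand_subgraph G \<delta> \<gamma>', \<delta>)"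
        and j = "\<lambda>(\<gamma>, \<delta>). (\<delta>, contract_subgraph G \<delta> \<gamma>)"], goal_cases)
    case (1 p)
    then obtain \<gamma> \<delta> where "p = (\<gamma>, \<delta>)" "\<gamma> \<in> ?A G" "\<delta> \<in> ?A \<gamma>" by auto
    then show ?case
      using expand_contract_subgraph admissible_subgraphsD(1) by fastforce
  next
    case (2 p)
    then obtain \<gamma> \<delta> where "p = (\<gamma>, \<delta>)" "\<gamma> \<in> ?A G" "\<delta> \<in> ?A \<gamma>" by auto
    then show ?case
      using admissible_nested_iff[OF G, of \<gamma> \<delta> E V] admissible_subgraphsD(1) by auto
  next
    case (3 q)
    then obtain \<delta> \<gamma>' where "q = (\<delta>, \<gamma>')" "\<delta> \<in> ?A G" "\<gamma>' \<in> ?A (contract G \<delta>)" by auto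
    then show ?case
      using contract_expand_subgraph admissible_subgraphsD(1) by fastforce
  next
    case (4 q)
    then obtain \<delta> \<gamma>' where q: "q = (\<delta>, \<gamma>')" "\<delta> \<in> ?A G" "\<gamma>' \<in> ?A (contract G \<delta>)" by auto
    note \<gamma>' = admissible_subgraphsD(1)[OF q(3)]
    note e = expand_subgraph_covering[OF G admissible_subgraphsD(1)[OF q(2)] \<gamma>']
    show ?case
      using admissible_nested_iff[OF G e, of E V] q contract_expand_subgraph[OF \<gamma>'] by simp
  next
    case (5 p)
    then obtain \<gamma> \<delta> where p: "p = (\<gamma>, \<delta>)" "\<gamma> \<in> ?A G" "\<delta> \<in> ?A \<gamma>" by auto
    note \<gamma> = admissible_subgraphsD(1)[OF p(2)] and \<delta> = admissible_subgraphsD(1)[OF p(3)]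
    note \<delta>G = covering_subgraph_trans[OF \<delta> \<gamma>]
    have "iso_class (contract \<gamma> \<delta>) = iso_class (contract_subgraph G \<delta> \<gamma>)"
      by (rule is_iso_imp_iso_class_eq[OF feynman_graph_contract[OF feynman_graph_covering[OF G \<gamma>] \<delta>]
            iso_contract_subgraph[OF \<gamma>]])
    moreover have "iso_class (contract (contract G \<delta>) (contract_subgraph G \<delta> \<gamma>)) =
        iso_class (contract G \<gamma>)"
      by (rule is_iso_imp_iso_class_eq[OF feynman_graph_contract[OF feynman_graph_contract[OF G \<delta>G]
              contract_subgraph_covering[OF G \<gamma> \<delta>]] iso_contract_contract[OF G \<gamma> \<delta>]])
    ultimately show ?case by (simp add: p(1))
  qed
  also have "\<dots> = (\<Sum>\<delta>\<in>?A G. \<Sum>\<gamma>'\<in>?A (contract G \<delta>).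
        basis_vector (iso_class \<delta>, iso_class \<gamma>', iso_class (contract (contract G \<delta>) \<gamma>')))"
    by (rule sum.Sigma[symmetric])
      (auto intro: finite_admissible_subgraphs G admissible_subgraphsD(5)[OF _ G])
  also have "\<dots> = tensor_map id (coproduct E V) (coproduct E V x)"
    unfolding x_def coproduct_basis[OF G] tensor_map_sum_basis
    by (intro sum.cong refl)
      (simp add: coproduct_basis[OF admissible_subgraphsD(5)[OF _ G]] tensor_sum_right)
  finally show ?thesis .
qed

lemma coproduct_add_basis:
  assumes G: "feynman_graph G" and H: "feynman_graph H"
  shows "coproduct E V (basis_vector (iso_class G + iso_class H)) =
    coproduct E V (basis_vector (iso_class G)) * coproduct E V (basis_vector (iso_class H))"
proof -
  let ?A = "admissible_subgraphs E V"
  have iso: "is_iso (case_sum ((`) Inl) ((`) Inr)) id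
      (disjoint_union (contract G \<gamma>) (contract H \<eta>))
      (contract (disjoint_union G H) (disjoint_union \<gamma> \<eta>))"
    "feynman_graph (disjoint_union (contract G \<gamma>) (contract H \<eta>))"
    "feynman_graph \<gamma>" "feynman_graph \<eta>" "feynman_graph (contract G \<gamma>)" "feynman_graph (contract H \<eta>)"
    if "\<gamma> \<in> covering_subgraphs G" "\<eta> \<in> covering_subgraphs H" for \<gamma> \<eta>
    using that G H by (auto intro: iso_contract_disjoint_union feynman_graph_disjoint_union
        feynman_graph_contract feynman_graph_covering)
  have adm: "disjoint_union \<gamma> \<eta> \<in> ?A (disjoint_union G H) \<longleftrightarrow> \<gamma> \<in> ?A G \<and> \<eta> \<in> ?A H"
    if "\<gamma> \<in> covering_subgraphs G" "\<eta> \<in> covering_subgraphs H" for \<gamma> \<eta>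
    using that disjoint_union_covering[OF that] is_iso_in_theory_iff[OF iso(2,1)[OF that], of E V]
    by (auto simp: admissible_subgraphs_def in_theory_disjoint_union
        locally_1PI_disjoint_union[OF iso(3,4)[OF that]])
  have "coproduct E V (basis_vector (iso_class G + iso_class H)) =
      (\<Sum>\<theta>\<in>?A (disjoint_union G H).
        basis_vector (iso_class \<theta>, iso_class (contract (disjoint_union G H) \<theta>)))"
    by (simp only: iso_class_disjoint_union[OF G H]
        coproduct_basis[OF feynman_graph_disjoint_union[OF G H]])
  also have "\<dots> = (\<Sum>(\<gamma>, \<eta>)\<in>?A G \<times> ?A H.
      basis_vector (iso_class \<gamma> + iso_class \<eta>, iso_class (contract G \<gamma>) + iso_class (contract H \<eta>)))"
  proof (rule sum.reindex_bij_witness[where i = "\<lambda>(\<gamma>, \<eta>). disjoint_union \<gamma> \<eta>"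
        and j = "\<lambda>\<theta>. (left_subgraph G \<theta>, right_subgraph H \<theta>)"], goal_cases)
    case (1 \<theta>)
    then show ?case using covering_disjoint_unionE(3)[OF admissible_subgraphsD(1)] by simp
  next
    case (2 \<theta>)
    note E = covering_disjoint_unionE[OF admissible_subgraphsD(1)[OF 2]]
    show ?case using adm[OF E(1,2)] 2 E(3) by simp
  next
    case (3 p)
    then obtain \<gamma> \<eta> where p: "p = (\<gamma>, \<eta>)" "\<gamma> \<in> ?A G" "\<eta> \<in> ?A H" by auto
    show ?case
      by (simp add: p(1) subgraphs_disjoint_union[OF admissible_subgraphsD(1)[OF p(2)]
            admissible_subgraphsD(1)[OF p(3)]])
  next
    case (4 p)
    then obtain \<gamma> \<eta> where p: "p = (\<gamma>, \<eta>)" "\<gamma> \<in> ?A G" "\<eta> \<in> ?A H" by auto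
    show ?case
      using adm[OF admissible_subgraphsD(1)[OF p(2)] admissible_subgraphsD(1)[OF p(3)]] p by simp
  next
    case (5 \<theta>)
    note E = covering_disjoint_unionE[OF admissible_subgraphsD(1)[OF 5]]
    note I = iso[OF E(1,2)]
    show ?case
      by (simp add: iso_class_disjoint_union[OF I(3,4)] iso_class_disjoint_union[OF I(5,6)]
          is_iso_imp_iso_class_eq[OF I(2,1)] E(3))
  qed
  also have "\<dots> = coproduct E V (basis_vector (iso_class G)) * coproduct E V (basis_vector (iso_class H))"
    unfolding coproduct_basis[OF G] coproduct_basis[OF H]
    by (simp add: sum_product sum.cartesian_product mult_single plus_prod_def)
  finally show ?thesis .
qed

lemma coproduct_zero_basis: "coproduct E V (basis_vector 0) = 1"
proof -
  let ?e = "empty_graph :: (nat, nat, 'a) fgraph"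
  have fe: "feynman_graph ?e" by (rule feynman_graph_empty)
  have "\<gamma> = ?e" if "\<gamma> \<in> covering_subgraphs ?e" for \<gamma>
  proof -
    note C = covering_subgraphD[OF that]
    have "invol \<gamma> = invol ?e" using C(5) by (auto simp: empty_graph_def)
    then show ?thesis using C(8) by simp
  qed
  moreover have "?e \<in> admissible_subgraphs E V ?e"
    using divergent_graph_empty covering_subgraph_self[OF fe]
    by (auto simp: admissible_subgraphs_def divergent_graph_def)
  ultimately have adm: "admissible_subgraphs E V ?e = {?e}"
    using admissible_subgraphsD(1) by blast
  have "is_iso (\<lambda>_. undefined) id (contract ?e ?e) ?e"
    by (simp add: is_iso_def bij_betw_def contract_def components_def empty_graph_def)
  then have "iso_class (contract ?e ?e) = 0"
    using is_iso_imp_iso_class_eq[OF feynman_graph_contract[OF fe covering_subgraph_self[OF fe]]]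
      iso_class_empty by metis
  then show ?thesis
    using coproduct_basis[OF fe, of E V]
    by (simp add: adm iso_class_empty single_one flip: zero_prod_def)
qed

definition edgeless_counit :: "('t igraph \<Rightarrow>\<^sub>0 complex) \<Rightarrow> complex" where
  "edgeless_counit = linear_extension (*) (\<lambda>x. of_bool (edgeless_class x))"

lemma edgeless_counit_basis: "edgeless_counit (basis_vector x) = of_bool (edgeless_class x)"
  by (simp add: edgeless_counit_def linear_extension_basis[OF vector_space_mult])

lemma counit_left_basis:
  assumes G: "feynman_graph G" and "in_theory E V G"
  shows "form_left edgeless_counit (coproduct E V (basis_vector (iso_class G))) =
    basis_vector (iso_class G)"
proof -
  let ?A = "admissible_subgraphs E V G"
  note d = discrete_subgraph[OF G]
  have "in_theory E V (contract G (discrete_subgraph G))"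
    using is_iso_in_theory_iff[OF G d(3)] assms(2) by blast
  then have mem: "discrete_subgraph G \<in> ?A" using d by (simp add: admissible_subgraphs_def)
  have "edgeless_class (iso_class \<gamma>) \<longleftrightarrow> \<gamma> = discrete_subgraph G" if "\<gamma> \<in> ?A" for \<gamma>
    using edgeless_class_iff[OF admissible_subgraphsD(4)[OF that G]] d(4)
      discrete_subgraph_unique[OF admissible_subgraphsD(1)[OF that]] by blast
  then have "form_left edgeless_counit (coproduct E V (basis_vector (iso_class G))) =
      (\<Sum>\<gamma>\<in>?A. if \<gamma> = discrete_subgraph G then basis_vector (iso_class (contract G \<gamma>)) else 0)"
    unfolding coproduct_basis[OF G] form_left_def linear_extension_sum[OF scale.vector_space_axioms]
    by (intro sum.cong refl)
      (simp add: linear_extension_basis[OF scale.vector_space_axioms] edgeless_counit_basis)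
  also have "\<dots> = basis_vector (iso_class G)"
    using mem finite_admissible_subgraphs[OF G] is_iso_imp_iso_class_eq[OF G d(3)] by simp
  finally show ?thesis .
qed

lemma counit_right_basis:
  assumes G: "feynman_graph G" and D: "divergent_graph E V G"
  shows "form_right edgeless_counit (coproduct E V (basis_vector (iso_class G))) =
    basis_vector (iso_class G)"
proof -
  let ?A = "admissible_subgraphs E V G"
  have mem: "G \<in> ?A"
    using D covering_subgraph_self[OF G] by (simp add: admissible_subgraphs_def divergent_graph_def)
  have "edgeless_class (iso_class (contract G \<gamma>)) \<longleftrightarrow> \<gamma> = G" if "\<gamma> \<in> ?A" for \<gamma>
  proof -
    note C = covering_subgraphD[OF admissible_subgraphsD(1)[OF that]]
    have "\<gamma> = G" if fixed: "\<forall>e\<in>hedges G. invol \<gamma> e = e \<longrightarrow> invol G e = e"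
    proof -
      have "invol \<gamma> e = invol G e" for e
        using fixed C(5,6)[of e] by metis
      then have "invol \<gamma> = invol G" by blast
      then show ?thesis using C(8) by simp
    qed
    then show ?thesis
      unfolding edgeless_class_iff[OF admissible_subgraphsD(5)[OF that G]] by auto
  qed
  then have "form_right edgeless_counit (coproduct E V (basis_vector (iso_class G))) =
      (\<Sum>\<gamma>\<in>?A. if \<gamma> = G then basis_vector (iso_class \<gamma>) else 0)"
    unfolding coproduct_basis[OF G] form_right_def linear_extension_sum[OF scale.vector_space_axioms]
    by (intro sum.cong refl)
      (simp add: linear_extension_basis[OF scale.vector_space_axioms] edgeless_counit_basis)
  also have "\<dots> = basis_vector (iso_class G)"
    using mem finite_admissible_subgraphs[OF G] by simp
  finally show ?thesis .
qed

lemma edgeless_class_zero: "edgeless_class 0"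
  unfolding edgeless_class_def using feynman_graph_empty iso_class_empty
  by (intro exI[of _ empty_graph]) (simp add: empty_graph_def)

lemma edgeless_class_add:
  assumes "feynman_graph G" "feynman_graph H"
  shows "edgeless_class (iso_class G + iso_class H) \<longleftrightarrow>
    edgeless_class (iso_class G) \<and> edgeless_class (iso_class H)"
  unfolding iso_class_disjoint_union[OF assms] edgeless_class_iff[OF assms(1)]
    edgeless_class_iff[OF assms(2)] edgeless_class_iff[OF feynman_graph_disjoint_union[OF assms]]
  by (auto simp: Plus_def ball_Un)

theorem theorem1:
  fixes E :: "'t set" and V :: "('t \<Rightarrow> nat) set"
  assumes "field_theory E V"
  shows "\<exists>\<epsilon>. bialgebra (divergent_classes E V) (coproduct E V) \<epsilon>"
proof -
  let ?B = "divergent_classes E V" and ?\<Delta> = "coproduct E V"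
  let ?\<epsilon> = "edgeless_counit :: ('t igraph \<Rightarrow>\<^sub>0 complex) \<Rightarrow> complex"
  note vs = scale.vector_space_axioms
  have linear_\<Delta>: "linear_on S scale ?\<Delta>" for S
    unfolding coproduct_def by (rule linear_on_linear_extension[OF vs])
  have linear_\<epsilon>: "linear_on S (*) ?\<epsilon>" for S
    unfolding edgeless_counit_def by (rule linear_on_linear_extension[OF vector_space_mult])
  have linear_id: "linear_on S scale (\<lambda>a. a)" for S :: "('t igraph \<Rightarrow>\<^sub>0 complex) set"
    by (simp add: linear_on_def)
  have zero_mem: "0 \<in> ?B"
    using iso_class_mem_divergent_classes[OF feynman_graph_empty] divergent_graph_empty
      iso_class_empty by metis
  have add_mem: "x + y \<in> ?B" if x: "x \<in> ?B" and y: "y \<in> ?B" for x y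
  proof -
    obtain G H :: "(nat, nat, 't) fgraph" where G: "x = iso_class G" "feynman_graph G"
      "divergent_graph E V G" and H: "y = iso_class H" "feynman_graph H" "divergent_graph E V H"
      using divergent_classesE[OF x] divergent_classesE[OF y] by metis
    then show ?thesis
      using iso_class_mem_divergent_classes[OF feynman_graph_disjoint_union[OF G(2) H(2)]]
        divergent_graph_disjoint_union[OF G(2) H(2) G(3) H(3)]
        iso_class_disjoint_union[OF G(2) H(2)] by simp
  qed
  have "bialgebra ?B ?\<Delta> ?\<epsilon>"
  proof
    show "linear_on (free_space ?B) scale ?\<Delta>" by (rule linear_\<Delta>)
    show "linear_on (free_space ?B) (*) ?\<epsilon>" by (rule linear_\<epsilon>)
    show "?\<Delta> a \<in> free_space (?B \<times> ?B)" if a: "a \<in> free_space ?B" for a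
    proof -
      have "?\<Delta> (basis_vector x) \<in> free_space (?B \<times> ?B)" if x: "x \<in> ?B" for x
      proof -
        obtain G :: "(nat, nat, 't) fgraph" where G: "x = iso_class G" "feynman_graph G"
          "divergent_graph E V G" using divergent_classesE[OF x] .
        have "(iso_class \<gamma>, iso_class (contract G \<gamma>)) \<in> ?B \<times> ?B"
          if "\<gamma> \<in> admissible_subgraphs E V G" for \<gamma>
          using divergent_graph_subgraph[OF G(2) _ that] divergent_graph_contract[OF G(2,3) that] G(3)
          by (simp add: divergent_graph_def
              iso_class_mem_divergent_classes[OF admissible_subgraphsD(4)[OF that G(2)]]
              iso_class_mem_divergent_classes[OF admissible_subgraphsD(5)[OF that G(2)]])
        then show ?thesis
          unfolding G(1) coproduct_basis[OF G(2)]
          by (intro scale.subspace_sum[OF subspace_free_space]) (simp add: free_space_def)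
      qed
      then show ?thesis
        unfolding linear_on_extension[OF linear_\<Delta> vs a] linear_extension_def
        using a by (intro scale.subspace_sum[OF subspace_free_space]
            scale.subspace_scale[OF subspace_free_space]) (auto simp: free_space_def)
    qed
    show "tensor_assoc (tensor_map ?\<Delta> id (?\<Delta> a)) = tensor_map id ?\<Delta> (?\<Delta> a)"
      if "a \<in> free_space ?B" for a
    proof (rule linear_on_eqI[OF vs _ _ _ that])
      show "linear_on (free_space ?B) scale (\<lambda>a. tensor_assoc (tensor_map ?\<Delta> id (?\<Delta> a)))"
        unfolding tensor_assoc_def tensor_map_def
        by (rule linear_on_comp[OF linear_on_comp[OF linear_\<Delta>]] linear_on_linear_extension[OF vs])+
      show "linear_on (free_space ?B) scale (\<lambda>a. tensor_map id ?\<Delta> (?\<Delta> a))"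
        unfolding tensor_map_def
        by (rule linear_on_comp[OF linear_\<Delta>] linear_on_linear_extension[OF vs])+
    qed (elim divergent_classesE, simp only: coproduct_coassoc_basis)
    show "form_left ?\<epsilon> (?\<Delta> a) = a" if "a \<in> free_space ?B" for a
    proof (rule linear_on_eqI[OF vs _ linear_id _ that])
      show "linear_on (free_space ?B) scale (\<lambda>a. form_left ?\<epsilon> (?\<Delta> a))"
        unfolding form_left_def
        by (rule linear_on_comp[OF linear_\<Delta>] linear_on_linear_extension[OF vs])+
    qed (auto elim!: divergent_classesE simp: counit_left_basis divergent_graph_def)
    show "form_right ?\<epsilon> (?\<Delta> a) = a" if "a \<in> free_space ?B" for a
    proof (rule linear_on_eqI[OF vs _ linear_id _ that])
      show "linear_on (free_space ?B) scale (\<lambda>a. form_right ?\<epsilon> (?\<Delta> a))"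
        unfolding form_right_def
        by (rule linear_on_comp[OF linear_\<Delta>] linear_on_linear_extension[OF vs])+
    qed (auto elim!: divergent_classesE simp: counit_right_basis)
    show "(1 :: 't igraph \<Rightarrow>\<^sub>0 complex) \<in> free_space ?B"
      using zero_mem by (simp add: free_space_def)
    show "a * b \<in> free_space ?B" if "a \<in> free_space ?B" "b \<in> free_space ?B"
      for a b :: "'t igraph \<Rightarrow>\<^sub>0 complex"
      using keys_mult[of a b] that add_mem by (fastforce simp: free_space_def)
    show "?\<Delta> 1 = 1" using coproduct_zero_basis[of E V] by (simp add: single_one)
    show "?\<Delta> (a * b) = ?\<Delta> a * ?\<Delta> b" if ab: "a \<in> free_space ?B" "b \<in> free_space ?B" for a b
      by (rule multiplicative_onI[OF vs scale_mult(1) linear_\<Delta> _ ab])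
        (auto elim!: divergent_classesE simp: coproduct_add_basis)
    show "?\<epsilon> 1 = 1"
      using edgeless_counit_basis[of "0 :: 't igraph"] edgeless_class_zero by (simp add: single_one)
    show "?\<epsilon> (a * b) = ?\<epsilon> a * ?\<epsilon> b" if ab: "a \<in> free_space ?B" "b \<in> free_space ?B" for a b
      by (rule multiplicative_onI[OF vector_space_mult mult.assoc linear_\<epsilon> _ ab])
        (auto elim!: divergent_classesE simp: edgeless_counit_basis edgeless_class_add)
  qed
  then show ?thesis by blast
qed

end
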